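(* Let $d,\ell,m$ be integers with $d\geq 1$ odd, $\ell\geq 0$ and $m\geq 3$. Suppose that either $d\equiv (-1)^\ell \pmod 6$, or $m$ is even and $d\equiv 3\pmod 6$, or $m$ is odd and $d\equiv 9 \pmod{18}$. Then there exists an abelian group $G$ of order $2^{\ell+m}d$ such that (1) $G$ has exactly $f=2^m-1$ involutions (elements of order $2$), and (2) there exists a $(G,\{2^f,3^e\},3,1)$-difference family for some $e\in\{0,1,2\}$.
   Context: Let $(G,+)$ be a finite abelian group. A partial spread of $G$ is a family $\Sigma$ of subgroups of $G$ whose members pairwise intersect trivially; it has type $\{n_1^{f_1},\dots,n_t^{f_t}\}$ if it consists of exactly $f_i$ subgroups of order $n_i$ for each $i$ (and no others). For a triple $T=\{a,b,c\}$ of three distinct elements of $G$, its list of differences is the multiset $\Delta T=\{\pm(a-b),\pm(a-c),\pm(b-c)\}$, and for a set $\mathcal T$ of triples, $\Delta\mathcal T$ is the multiset union of the $\Delta T$, $T\in\mathcal T$. For a partial spread $\Sigma$, a $(G,\Sigma,3,1)$-difference family is a set $\mathcal T$ of triples of $G$ such that $\Delta\mathcal T=G\setminus\bigcup_{S\in\Sigma}S$ as multisets (every element outside $\bigcup_{S\in\Sigma}S$ occurs exactly once in $\Delta\mathcal T$, and no element of $\bigcup_{S\in\Sigma}S$ occurs). A $(G,\tau,3,1)$-difference family, for a type $\tau$, is a $(G,\Sigma,3,1)$-difference family for some partial spread $\Sigma$ of $G$ of type $\tau$. *)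

theory Defs
  imports
    "HOL-Algebra.Multiplicative_Group"
    "HOL-Number_Theory.Cong"
    "HOL-Library.Multiset"
begin

text \<open>
  Abelian groups are rendered as \<^const>\<open>comm_group\<close>, i.e. multiplicatively:
  the difference \<open>a - b\<close> of the additive notation is \<open>a \<otimes> inv b\<close>, and \<open>0\<close> is \<open>\<one>\<close>.
\<close>

definition partial_spread :: "('a, 'b) monoid_scheme \<Rightarrow> 'a set set \<Rightarrow> bool" where
  "partial_spread G \<Sigma> \<longleftrightarrow>
     (\<forall>S\<in>\<Sigma>. subgroup S G) \<and> pairwise (\<lambda>S S'. S \<inter> S' = {\<one>\<^bsub>G\<^esub>}) \<Sigma>"

text \<open>
  A type \<open>{n\<^sub>1^f\<^sub>1, \<dots>, n\<^sub>t^f\<^sub>t}\<close> is the multiset in which each \<open>n\<^sub>i\<close> has multiplicity \<open>f\<^sub>i\<close>.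
  Over a finite group \<open>\<Sigma>\<close> is automatically finite, so \<^const>\<open>mset_set\<close> is not degenerate.
\<close>

definition partial_spread_of_type ::
  "('a, 'b) monoid_scheme \<Rightarrow> nat multiset \<Rightarrow> 'a set set \<Rightarrow> bool" where
  "partial_spread_of_type G \<tau> \<Sigma> \<longleftrightarrow>
     partial_spread G \<Sigma> \<and> image_mset card (mset_set \<Sigma>) = \<tau>"

definition is_triple :: "('a, 'b) monoid_scheme \<Rightarrow> 'a set \<Rightarrow> bool" where
  "is_triple G T \<longleftrightarrow> T \<subseteq> carrier G \<and> card T = 3"

text \<open>
  All ordered pairs of distinct elements contribute; for \<open>T = {a, b, c}\<close> it consists
  of the six elements \<open>\<plusminus>(a - b), \<plusminus>(a - c), \<plusminus>(b - c)\<close>, counted with multiplicity.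
\<close>

definition differences :: "('a, 'b) monoid_scheme \<Rightarrow> 'a set \<Rightarrow> 'a multiset" where
  "differences G T =
     image_mset (\<lambda>(x, y). x \<otimes>\<^bsub>G\<^esub> inv\<^bsub>G\<^esub> y) (mset_set {(x, y). x \<in> T \<and> y \<in> T \<and> x \<noteq> y})"

definition difference_family ::
  "('a, 'b) monoid_scheme \<Rightarrow> 'a set set \<Rightarrow> 'a set set \<Rightarrow> bool" where
  "difference_family G \<Sigma> \<T> \<longleftrightarrow>
     (\<forall>T\<in>\<T>. is_triple G T) \<and>
     (\<Sum>T\<in>\<T>. differences G T) = mset_set (carrier G - \<Union>\<Sigma>)"

definition difference_family_of_type ::
  "('a, 'b) monoid_scheme \<Rightarrow> nat multiset \<Rightarrow> 'a set set \<Rightarrow> bool" where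
  "difference_family_of_type G \<tau> \<T> \<longleftrightarrow>
     (\<exists>\<Sigma>. partial_spread_of_type G \<tau> \<Sigma> \<and> difference_family G \<Sigma> \<T>)"

definition involutions :: "('a, 'b) monoid_scheme \<Rightarrow> 'a set" where
  "involutions G = {x \<in> carrier G. group.ord G x = 2}"

end

theory Submission
  imports Defs "HOL-Algebra.Elementary_Groups"
begin

text \<open>
  A triple \<open>{a, b, c}\<close> contributes \<open>\<plusminus>x, \<plusminus>y, \<plusminus>z\<close> with \<open>x + y + z = 0\<close>, so the task is to partition the
  elements outside the partial spread, up to sign, into zero-sum triples. If \<open>W\<close> has a complete
  mapping, i.e. permutations \<open>\<alpha>, \<beta>, \<gamma>\<close> with \<open>\<alpha> + \<beta> + \<gamma> = 0\<close>, then a zero-sum triple \<open>(x, y, z)\<close> of \<open>G\<close> lifts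
  to the triples \<open>(x, \<alpha> w), (y, \<beta> w), (z, \<gamma> w)\<close> of \<open>G \<times> W\<close>. With \<open>W = \<int>\<^sub>2\<^sup>2 = F\<^sub>4\<close> this raises \<open>m\<close> by \<open>2\<close>:
  an excluded element \<open>t\<close> of order \<open>3\<close> only leaves the extra zero-sum triple formed by \<open>(t, u)\<close>,
  \<open>u \<in> F\<^sub>4 - {0}\<close>. So only \<open>m = 3\<close> and \<open>m = 4\<close> matter.

  If \<open>d \<equiv> (-1)^l\<close>, take \<open>G = \<int>\<^sub>N \<times> V\<close> with \<open>N = 2^(l+1) d = 6k + 2\<close> and \<open>V = \<int>\<^sub>2\<^sup>2\<close> or \<open>\<int>\<^sub>2\<^sup>3\<close>. The
  layers \<open>1, \<dots>, 3k\<close> are covered twice by triples \<open>r + b = c\<close>, where \<open>1 \<le> r \<le> k\<close> and the edges \<open>bc\<close> run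
  through two zigzag paths on \<open>(k, 2k]\<close> and \<open>(2k, 3k]\<close> joined to a cycle of even length; a
  2-colouring of this cycle allows each of the two covers to be lifted to one half of \<open>V\<close>.

  Otherwise take \<open>G = \<int>\<^sub>3 \<times> \<int>\<^sub>k \<times> T \<times> \<int>\<^sub>N \<times> V\<close> with \<open>N = 2^(l+1)\<close> and \<open>T\<close> of order \<open>1\<close> or \<open>3\<close>. If \<open>8 | N\<close>,
  the triples \<open>a, a + N/2, -(2a + N/2)\<close> with \<open>a \<equiv> 1 (mod 4)\<close> use up exactly the residues of \<open>\<int>\<^sub>N\<close> that
  are not divisible by \<open>4\<close>, which reduces \<open>N\<close> to \<open>N/4\<close>; Bose's triples \<open>(1, i), (2, i), (0, -2i)\<close> of
  \<open>\<int>\<^sub>3 \<times> \<int>\<^sub>k\<close> reduce \<open>k\<close> to \<open>1\<close>. Four finite groups remain, with explicit solutions.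
\<close>

section \<open>Zero-sum triples\<close>

definition zero_sum_triples :: "('a, 'b) monoid_scheme \<Rightarrow> ('a \<times> 'a \<times> 'a) set" where
  "zero_sum_triples G =
     {(x, y, z). x \<in> carrier G \<and> y \<in> carrier G \<and> z \<in> carrier G \<and> x \<otimes>\<^bsub>G\<^esub> y \<otimes>\<^bsub>G\<^esub> z = \<one>\<^bsub>G\<^esub>}"

definition signed_parts :: "('a, 'b) monoid_scheme \<Rightarrow> ('a \<times> 'a \<times> 'a) set \<Rightarrow> 'a set" where
  "signed_parts G B = (\<Union>(x, y, z)\<in>B. {x, y, z, inv\<^bsub>G\<^esub> x, inv\<^bsub>G\<^esub> y, inv\<^bsub>G\<^esub> z})"

text \<open>
  The triples in \<open>B\<close> have \<open>6 \<cdot> card B\<close> signed components in total, so the cardinality bound forces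
  each element of \<open>X\<close> to be a signed component exactly once and no other element to occur.
\<close>

definition decomposable :: "('a, 'b) monoid_scheme \<Rightarrow> 'a set \<Rightarrow> bool" where
  "decomposable G X \<longleftrightarrow> X \<subseteq> carrier G \<and> finite X \<and>
     (\<exists>B. finite B \<and> B \<subseteq> zero_sum_triples G \<and> X \<subseteq> signed_parts G B \<and> 6 * card B \<le> card X)"

text \<open>Each of the three projections of \<open>C\<close> is onto and \<open>card C\<close> is
  at most the order, so all three are bijections: \<open>C\<close> consists of the triples
  \<open>(\<alpha> w, \<beta> w, \<gamma> w)\<close> of three permutations, without naming
  them.\<close>

definition has_complete_mapping :: "('a, 'b) monoid_scheme \<Rightarrow> bool" where
  "has_complete_mapping G \<longleftrightarrow> finite (carrier G) \<and>
     (\<exists>C. finite C \<and> C \<subseteq> zero_sum_triples G \<and> card C \<le> order G \<and>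
        (\<forall>w\<in>carrier G. (\<exists>y z. (w, y, z) \<in> C) \<and> (\<exists>x z. (x, w, z) \<in> C) \<and> (\<exists>x y. (x, y, w) \<in> C)))"

section \<open>Unions, images and products of decompositions\<close>

lemma comm_group_DirProd:
  assumes "comm_group G" "comm_group H"
  shows "comm_group (G \<times>\<times> H)"
proof -
  interpret G: comm_group G by fact
  interpret H: comm_group H by fact
  interpret GH: group "G \<times>\<times> H" by (rule DirProd_group) (auto intro: G.is_group H.is_group)
  show ?thesis
    by (rule GH.group_comm_groupI) (auto simp: G.m_comm H.m_comm)
qed

lemma signed_partsI:
  "(x, y, z) \<in> B \<Longrightarrow> {x, y, z, inv\<^bsub>G\<^esub> x, inv\<^bsub>G\<^esub> y, inv\<^bsub>G\<^esub> z} \<subseteq> signed_parts G B"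
  unfolding signed_parts_def by blast

lemma (in group) signed_parts_inv:
  assumes "B \<subseteq> zero_sum_triples G" "x \<in> signed_parts G B"
  shows "inv x \<in> signed_parts G B"
  using assms unfolding signed_parts_def zero_sum_triples_def
  by (fastforce simp: inv_inv)

lemma decomposable_Un:
  assumes "decomposable G X" "decomposable G Y" "X \<inter> Y = {}"
  shows "decomposable G (X \<union> Y)"
proof -
  obtain B where B: "finite B" "B \<subseteq> zero_sum_triples G" "X \<subseteq> signed_parts G B" "6 * card B \<le> card X"
    using assms(1) unfolding decomposable_def by blast
  obtain C where C: "finite C" "C \<subseteq> zero_sum_triples G" "Y \<subseteq> signed_parts G C" "6 * card C \<le> card Y"
    using assms(2) unfolding decomposable_def by blast
  have fin: "finite X" "finite Y" "X \<subseteq> carrier G" "Y \<subseteq> carrier G"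
    using assms unfolding decomposable_def by auto
  have "6 * card (B \<union> C) \<le> card (X \<union> Y)"
    using card_Un_le[of B C] B(4) C(4) card_Un_disjoint[OF fin(1,2) assms(3)] by linarith
  moreover have "X \<union> Y \<subseteq> signed_parts G (B \<union> C)"
    using B(3) C(3) unfolding signed_parts_def by blast
  ultimately show ?thesis
    unfolding decomposable_def using fin B C by (intro conjI exI[of _ "B \<union> C"]) auto
qed

text \<open>Injectivity on the carrier is enough, so decompositions of a subgroup also pass to the
  larger group, for instance along \<open>a \<mapsto> 4 * a\<close>.\<close>

lemma decomposable_image:
  assumes "group G" "group H" "h \<in> hom G H" "inj_on h (carrier G)" "decomposable G X"
  shows "decomposable H (h ` X)"
proof -
  interpret G: group G by fact
  interpret H: group H by fact
  interpret group_hom G H h using assms(3) by unfold_locales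
  obtain B where B: "finite B" "B \<subseteq> zero_sum_triples G" "X \<subseteq> signed_parts G B" "6 * card B \<le> card X"
    using assms(5) unfolding decomposable_def by blast
  have X: "X \<subseteq> carrier G" "finite X" using assms(5) unfolding decomposable_def by auto
  let ?B = "(\<lambda>(x, y, z). (h x, h y, h z)) ` B"
  have "card (h ` X) = card X"
    using X assms(4) by (meson card_image inj_on_subset)
  moreover have "card ?B \<le> card B" using B(1) by (rule card_image_le)
  ultimately have "6 * card ?B \<le> card (h ` X)" using B(4) by linarith
  moreover have "?B \<subseteq> zero_sum_triples H"
    using B(2) unfolding zero_sum_triples_def by (auto simp flip: hom_mult)
  moreover have "h ` X \<subseteq> signed_parts H ?B"
  proof
    fix y assume "y \<in> h ` X"
    then obtain x where x: "x \<in> X" "y = h x" by auto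
    then obtain a b c where t: "(a, b, c) \<in> B" "x \<in> {a, b, c, inv\<^bsub>G\<^esub> a, inv\<^bsub>G\<^esub> b, inv\<^bsub>G\<^esub> c}"
      using B(3) unfolding signed_parts_def by blast
    then have "a \<in> carrier G" "b \<in> carrier G" "c \<in> carrier G"
      using B(2) unfolding zero_sum_triples_def by auto
    then have "y \<in> {h a, h b, h c, inv\<^bsub>H\<^esub> h a, inv\<^bsub>H\<^esub> h b, inv\<^bsub>H\<^esub> h c}"
      using t(2) x(2) by auto
    then show "y \<in> signed_parts H ?B" unfolding signed_parts_def using t(1) by force
  qed
  ultimately show ?thesis
    unfolding decomposable_def using B(1) X by (intro conjI exI[of _ ?B]) auto
qed

lemma zero_sum_triples_DirProd:
  assumes "(x, y, z) \<in> zero_sum_triples G" "(u, v, w) \<in> zero_sum_triples H"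
  shows "((x, u), (y, v), (z, w)) \<in> zero_sum_triples (G \<times>\<times> H)"
  using assms unfolding zero_sum_triples_def by auto

text \<open>The blocks are all pairs of a triple of \<open>B\<close> with a triple of
  \<open>C\<close>. Whatever place \<open>x\<close> takes in its triple, every \<open>w\<close>
  occurs at the same place in some triple of \<open>C\<close>. There are at most
  \<open>card B * card C\<close> blocks, so the cardinality bounds multiply.\<close>

lemma decomposable_DirProd:
  assumes "group G" "group W" "decomposable G X" "has_complete_mapping W"
  shows "decomposable (G \<times>\<times> W) (X \<times> carrier W)"
proof -
  interpret G: group G by fact
  interpret W: group W by fact
  interpret GW: group "G \<times>\<times> W" by (rule DirProd_group) fact+
  obtain B where B: "finite B" "B \<subseteq> zero_sum_triples G" "X \<subseteq> signed_parts G B" "6 * card B \<le> card X"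
    using assms(3) unfolding decomposable_def by blast
  have X: "X \<subseteq> carrier G" "finite X" using assms(3) unfolding decomposable_def by auto
  obtain C where C: "finite C" "C \<subseteq> zero_sum_triples W" "card C \<le> order W"
    "\<And>w. w \<in> carrier W \<Longrightarrow> (\<exists>y z. (w, y, z) \<in> C) \<and> (\<exists>x z. (x, w, z) \<in> C) \<and> (\<exists>x y. (x, y, w) \<in> C)"
    and finW: "finite (carrier W)"
    using assms(4) unfolding has_complete_mapping_def by blast
  let ?B = "(\<lambda>((x, y, z), (u, v, w)). ((x, u), (y, v), (z, w))) ` (B \<times> C)"
  have mem: "((x, u), (y, v), (z, w)) \<in> ?B" if "(x, y, z) \<in> B" "(u, v, w) \<in> C" for x y z u v w
    using that by force
  have sub: "?B \<subseteq> zero_sum_triples (G \<times>\<times> W)"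
    using B(2) C(2) by (auto intro!: zero_sum_triples_DirProd)
  have "card ?B \<le> card B * card C"
    using B(1) C(1) by (metis card_image_le card_cartesian_product finite_cartesian_product)
  then have "6 * card ?B \<le> card X * card (carrier W)"
    using mult_le_mono[OF B(4) C(3)] by (simp add: order_def)
  moreover have "X \<times> carrier W \<subseteq> signed_parts (G \<times>\<times> W) ?B"
  proof clarify
    fix x w assume x: "x \<in> X" and w: "w \<in> carrier W"
    then obtain a b c where t: "(a, b, c) \<in> B"
      and abc: "x \<in> {a, b, c, inv\<^bsub>G\<^esub> a, inv\<^bsub>G\<^esub> b, inv\<^bsub>G\<^esub> c}"
      using B(3) unfolding signed_parts_def by blast
    have car: "a \<in> carrier G" "b \<in> carrier G" "c \<in> carrier G"
      using t B(2) unfolding zero_sum_triples_def by auto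
    have pos: "(a, v) \<in> signed_parts (G \<times>\<times> W) ?B \<and> (b, v) \<in> signed_parts (G \<times>\<times> W) ?B \<and>
      (c, v) \<in> signed_parts (G \<times>\<times> W) ?B" if "v \<in> carrier W" for v
    proof -
      obtain p1 p2 q1 q2 r1 r2 where C': "(v, p1, p2) \<in> C" "(q1, v, q2) \<in> C" "(r1, r2, v) \<in> C"
        using C(4)[of v] \<open>v \<in> carrier W\<close> by blast
      have "((a, v), (b, p1), (c, p2)) \<in> ?B" "((a, q1), (b, v), (c, q2)) \<in> ?B"
        "((a, r1), (b, r2), (c, v)) \<in> ?B"
        using C'[THEN mem[OF t]] by auto
      from this[THEN signed_partsI[where G = "G \<times>\<times> W"]] show ?thesis
        by (simp only: insert_subset simp_thms)
    qed
    \<comment> \<open>A negated component with second coordinate \<open>w\<close> is the inverse of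
      a positive one with second coordinate \<open>inv w\<close>, which \<open>pos\<close>
      covers.\<close>
    have neg: "(inv\<^bsub>G\<^esub> a, w) \<in> signed_parts (G \<times>\<times> W) ?B \<and> (inv\<^bsub>G\<^esub> b, w) \<in> signed_parts (G \<times>\<times> W) ?B \<and>
      (inv\<^bsub>G\<^esub> c, w) \<in> signed_parts (G \<times>\<times> W) ?B"
    proof -
      have "inv\<^bsub>G \<times>\<times> W\<^esub> (y, inv\<^bsub>W\<^esub> w) = (inv\<^bsub>G\<^esub> y, w)" if "y \<in> carrier G" for y
        using inv_DirProd[OF assms(1,2) that, of "inv\<^bsub>W\<^esub> w"] w by simp
      then show ?thesis
        using pos[of "inv\<^bsub>W\<^esub> w"] w car GW.signed_parts_inv[OF sub] by fastforce
    qed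
    show "(x, w) \<in> signed_parts (G \<times>\<times> W) ?B" using abc pos[OF w] neg by blast
  qed
  ultimately show ?thesis
    unfolding decomposable_def using B(1) C(1) X sub finW
    by (intro conjI exI[of _ ?B]) (auto simp: card_cartesian_product)
qed

lemma has_complete_mapping_DirProd:
  assumes "has_complete_mapping V" "has_complete_mapping W"
  shows "has_complete_mapping (V \<times>\<times> W)"
proof -
  obtain B where B: "finite B" "B \<subseteq> zero_sum_triples V" "card B \<le> order V"
    "\<And>w. w \<in> carrier V \<Longrightarrow> (\<exists>y z. (w, y, z) \<in> B) \<and> (\<exists>x z. (x, w, z) \<in> B) \<and> (\<exists>x y. (x, y, w) \<in> B)"
    and finV: "finite (carrier V)"
    using assms(1) unfolding has_complete_mapping_def by blast
  obtain C where C: "finite C" "C \<subseteq> zero_sum_triples W" "card C \<le> order W"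
    "\<And>w. w \<in> carrier W \<Longrightarrow> (\<exists>y z. (w, y, z) \<in> C) \<and> (\<exists>x z. (x, w, z) \<in> C) \<and> (\<exists>x y. (x, y, w) \<in> C)"
    and finW: "finite (carrier W)"
    using assms(2) unfolding has_complete_mapping_def by blast
  let ?B = "(\<lambda>((x, y, z), (u, v, w)). ((x, u), (y, v), (z, w))) ` (B \<times> C)"
  have mem: "((x, u), (y, v), (z, w)) \<in> ?B" if "(x, y, z) \<in> B" "(u, v, w) \<in> C" for x y z u v w
    using that by force
  have sub: "?B \<subseteq> zero_sum_triples (V \<times>\<times> W)"
    using B(2) C(2) by (auto intro!: zero_sum_triples_DirProd)
  have "card ?B \<le> card B * card C"
    using B(1) C(1) by (metis card_image_le card_cartesian_product finite_cartesian_product)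
  also have "\<dots> \<le> order (V \<times>\<times> W)"
    using mult_le_mono[OF B(3) C(3)] by (simp add: order_def card_cartesian_product)
  finally have card: "card ?B \<le> order (V \<times>\<times> W)" .
  have "(\<exists>y z. (v, y, z) \<in> ?B) \<and> (\<exists>x z. (x, v, z) \<in> ?B) \<and> (\<exists>x y. (x, y, v) \<in> ?B)"
    if v: "v \<in> carrier (V \<times>\<times> W)" for v
  proof -
    obtain a b where ab: "v = (a, b)" "a \<in> carrier V" "b \<in> carrier W" using v by auto
    obtain p1 p2 q1 q2 r1 r2 where 1: "(a, p1, p2) \<in> B" "(q1, a, q2) \<in> B" "(r1, r2, a) \<in> B"
      using B(4)[OF ab(2)] by blast
    obtain p1' p2' q1' q2' r1' r2' where 2: "(b, p1', p2') \<in> C" "(q1', b, q2') \<in> C" "(r1', r2', b) \<in> C"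
      using C(4)[OF ab(3)] by blast
    have "(v, (p1, p1'), (p2, p2')) \<in> ?B" "((q1, q1'), v, (q2, q2')) \<in> ?B"
      "((r1, r1'), (r2, r2'), v) \<in> ?B"
      unfolding ab(1) using 1[THEN mem] 2 by auto
    then show ?thesis by blast
  qed
  then show ?thesis
    unfolding has_complete_mapping_def using card sub B(1) C(1) finV finW
    by (intro conjI exI[of _ ?B]) auto
qed

section \<open>From decompositions to difference families\<close>

text \<open>
  \<open>E\<close> contains one generator of each of the \<open>e\<close> subgroups of order \<open>3\<close> in the partial spread.
\<close>

definition pyramidal :: "('a, 'b) monoid_scheme \<Rightarrow> nat \<Rightarrow> nat \<Rightarrow> nat \<Rightarrow> bool" where
  "pyramidal G n m e \<longleftrightarrow> comm_group G \<and> finite (carrier G) \<and> order G = n \<and>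
     card {x \<in> carrier G. x \<otimes>\<^bsub>G\<^esub> x = \<one>\<^bsub>G\<^esub>} = 2 ^ m \<and>
     (\<exists>E \<subseteq> carrier G. card E = e \<and> (\<forall>t\<in>E. t \<noteq> \<one>\<^bsub>G\<^esub> \<and> t \<otimes>\<^bsub>G\<^esub> t \<otimes>\<^bsub>G\<^esub> t = \<one>\<^bsub>G\<^esub>) \<and>
        E \<inter> m_inv G ` E = {} \<and>
        decomposable G (carrier G - {x. x \<otimes>\<^bsub>G\<^esub> x = \<one>\<^bsub>G\<^esub>} - (E \<union> m_inv G ` E)))"

lemma pyramidal_iso:
  fixes G :: "'a monoid" and H :: "'b monoid"
  assumes "pyramidal G n m e" "comm_group H" "h \<in> iso G H"
  shows "pyramidal H n m e"
proof -
  interpret G: comm_group G using assms(1) unfolding pyramidal_def by blast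
  interpret H: comm_group H by fact
  have hom: "h \<in> hom G H" and bij: "bij_betw h (carrier G) (carrier H)"
    using assms(3) unfolding iso_def by auto
  then interpret group_hom G H h by unfold_locales
  have inj: "inj_on h (carrier G)" and im: "h ` carrier G = carrier H"
    using bij unfolding bij_betw_def by auto
  have fin: "finite (carrier G)" using assms(1) unfolding pyramidal_def by blast
  obtain E where E: "E \<subseteq> carrier G" "card E = e"
      "\<forall>t\<in>E. t \<noteq> \<one>\<^bsub>G\<^esub> \<and> t \<otimes>\<^bsub>G\<^esub> t \<otimes>\<^bsub>G\<^esub> t = \<one>\<^bsub>G\<^esub>" "E \<inter> m_inv G ` E = {}"
      "decomposable G (carrier G - {x. x \<otimes>\<^bsub>G\<^esub> x = \<one>\<^bsub>G\<^esub>} - (E \<union> m_inv G ` E))"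
    using assms(1) unfolding pyramidal_def by blast
  have one: "h x = \<one>\<^bsub>H\<^esub> \<longleftrightarrow> x = \<one>\<^bsub>G\<^esub>" if "x \<in> carrier G" for x
    using that inj by (metis hom_one inj_onD G.one_closed)
  have sq: "h x \<otimes>\<^bsub>H\<^esub> h x = \<one>\<^bsub>H\<^esub> \<longleftrightarrow> x \<otimes>\<^bsub>G\<^esub> x = \<one>\<^bsub>G\<^esub>" if "x \<in> carrier G" for x
    using one[of "x \<otimes>\<^bsub>G\<^esub> x"] that by simp
  have hI: "h ` {x \<in> carrier G. x \<otimes>\<^bsub>G\<^esub> x = \<one>\<^bsub>G\<^esub>} = {x \<in> carrier H. x \<otimes>\<^bsub>H\<^esub> x = \<one>\<^bsub>H\<^esub>}"
    unfolding im[symmetric] using sq by blast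
  have invE: "m_inv H ` h ` E = h ` m_inv G ` E"
    unfolding image_image using E(1) by (intro image_cong) auto
  have inv_sub: "m_inv G ` E \<subseteq> carrier G" using E(1) by auto
  have "h ` (carrier G - {x. x \<otimes>\<^bsub>G\<^esub> x = \<one>\<^bsub>G\<^esub>} - (E \<union> m_inv G ` E)) =
      carrier H - {x. x \<otimes>\<^bsub>H\<^esub> x = \<one>\<^bsub>H\<^esub>} - (h ` E \<union> m_inv H ` h ` E)"
  proof -
    let ?I = "{x \<in> carrier G. x \<otimes>\<^bsub>G\<^esub> x = \<one>\<^bsub>G\<^esub>}"
    have "h ` (carrier G - (?I \<union> (E \<union> m_inv G ` E))) = h ` carrier G - h ` (?I \<union> (E \<union> m_inv G ` E))"
      by (rule inj_on_image_set_diff[OF inj]) (use E(1) inv_sub in auto)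
    then have "h ` (carrier G - (?I \<union> (E \<union> m_inv G ` E)))
        = carrier H - ({x \<in> carrier H. x \<otimes>\<^bsub>H\<^esub> x = \<one>\<^bsub>H\<^esub>} \<union> (h ` E \<union> m_inv H ` h ` E))"
      unfolding image_Un invE im hI .
    moreover have "carrier G - (?I \<union> (E \<union> m_inv G ` E)) =
        carrier G - {x. x \<otimes>\<^bsub>G\<^esub> x = \<one>\<^bsub>G\<^esub>} - (E \<union> m_inv G ` E)" by blast
    moreover have "carrier H - ({x \<in> carrier H. x \<otimes>\<^bsub>H\<^esub> x = \<one>\<^bsub>H\<^esub>} \<union> (h ` E \<union> m_inv H ` h ` E)) =
        carrier H - {x. x \<otimes>\<^bsub>H\<^esub> x = \<one>\<^bsub>H\<^esub>} - (h ` E \<union> m_inv H ` h ` E)" by blast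
    ultimately show ?thesis by simp
  qed
  moreover have "decomposable H (h ` (carrier G - {x. x \<otimes>\<^bsub>G\<^esub> x = \<one>\<^bsub>G\<^esub>} - (E \<union> m_inv G ` E)))"
    by (rule decomposable_image[OF G.is_group H.is_group hom inj E(5)])
  ultimately have dec: "decomposable H (carrier H - {x. x \<otimes>\<^bsub>H\<^esub> x = \<one>\<^bsub>H\<^esub>} - (h ` E \<union> m_inv H ` h ` E))"
    by simp
  have "card {x \<in> carrier H. x \<otimes>\<^bsub>H\<^esub> x = \<one>\<^bsub>H\<^esub>} = card (h ` {x \<in> carrier G. x \<otimes>\<^bsub>G\<^esub> x = \<one>\<^bsub>G\<^esub>})"
    unfolding hI ..
  also have "\<dots> = 2 ^ m"
    using assms(1) card_image[OF inj_on_subset[OF inj, of "{x \<in> carrier G. x \<otimes>\<^bsub>G\<^esub> x = \<one>\<^bsub>G\<^esub>}"]]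
    unfolding pyramidal_def by auto
  finally have c: "card {x \<in> carrier H. x \<otimes>\<^bsub>H\<^esub> x = \<one>\<^bsub>H\<^esub>} = 2 ^ m" .
  have "card (h ` E) = e" using E(1,2) inj by (metis card_image inj_on_subset)
  moreover have "\<forall>t\<in>h ` E. t \<noteq> \<one>\<^bsub>H\<^esub> \<and> t \<otimes>\<^bsub>H\<^esub> t \<otimes>\<^bsub>H\<^esub> t = \<one>\<^bsub>H\<^esub>"
    using E(1,3) one by (auto simp: subset_iff simp flip: hom_mult)
  moreover have "h ` E \<inter> m_inv H ` h ` E = {}"
    using inj_on_image_Int[OF inj E(1) inv_sub] E(4) unfolding invE by simp
  moreover have "h ` E \<subseteq> carrier H" using E(1) im by auto
  moreover have "order H = n" using assms(1) bij_betw_same_card[OF bij] unfolding pyramidal_def order_def by simp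
  moreover have "finite (carrier H)" using fin unfolding im[symmetric] by (rule finite_imageI)
  ultimately show ?thesis
    unfolding pyramidal_def using dec c assms(2) by blast
qed

text \<open>Each construction yields a group of tuples of its own type. Renaming the finitely many
  elements by numbers brings all of them to one type, as the final statement and the repeated
  products require.\<close>

lemma pyramidal_nat:
  fixes G :: "'a monoid"
  assumes "pyramidal G n m e"
  shows "\<exists>H :: nat monoid. pyramidal H n m e"
proof -
  interpret G: comm_group G using assms unfolding pyramidal_def by blast
  have fin: "finite (carrier G)" using assms unfolding pyramidal_def by blast
  obtain f :: "'a \<Rightarrow> nat" where f: "inj_on f (carrier G)"
    using finite_imp_inj_to_nat_seg[OF fin] by auto
  define g where "g = inv_into (carrier G) f"
  have gf: "g (f x) = x" if "x \<in> carrier G" for x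
    using that f unfolding g_def by simp
  define H where "H = \<lparr>carrier = f ` carrier G, monoid.mult = (\<lambda>x y. f (g x \<otimes>\<^bsub>G\<^esub> g y)), one = f \<one>\<^bsub>G\<^esub>\<rparr>"
  have "comm_group H"
  proof (rule comm_groupI)
    fix x assume "x \<in> carrier H"
    then obtain y where "y \<in> carrier G" "x = f y" unfolding H_def by auto
    then show "\<exists>y\<in>carrier H. y \<otimes>\<^bsub>H\<^esub> x = \<one>\<^bsub>H\<^esub>"
      by (intro bexI[of _ "f (inv\<^bsub>G\<^esub> y)"]) (auto simp: gf H_def)
  qed (auto simp: H_def gf G.m_ac)
  moreover have "f \<in> iso G H"
    unfolding iso_def hom_def bij_betw_def using f by (auto simp: H_def gf)
  ultimately show ?thesis using pyramidal_iso[OF assms] by blast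
qed

text \<open>Up to inversion the three differences are \<open>x\<close>, \<open>y\<close> and
  \<open>x \<otimes> y = inv z\<close>. No component may be \<open>\<one>\<close>, since otherwise
  two of the three points coincide.\<close>

lemma (in comm_group) differences_triple:
  assumes "x \<in> carrier G" "y \<in> carrier G" "z \<in> carrier G" "x \<otimes> y \<otimes> z = \<one>"
    and "x \<noteq> \<one>" "y \<noteq> \<one>" "z \<noteq> \<one>"
  shows "differences G {\<one>, x, x \<otimes> y} = {#x, y, z, inv x, inv y, inv z#}"
    and "is_triple G {\<one>, x, x \<otimes> y}"
proof -
  have z2: "inv (x \<otimes> y) = z"
    by (rule inv_equality) (use assms in \<open>simp_all add: m_comm[of z "x \<otimes> y"]\<close>)
  then have z1: "inv z = x \<otimes> y" using assms by (metis inv_inv m_closed)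
  have ne: "\<one> \<noteq> x" "\<one> \<noteq> x \<otimes> y" "x \<noteq> x \<otimes> y"
    using assms(5,7) z2 inv_one l_cancel_one'[OF assms(1,2)] assms(6) by metis+
  have pairs: "{(a, b). a \<in> {\<one>, x, x \<otimes> y} \<and> b \<in> {\<one>, x, x \<otimes> y} \<and> a \<noteq> b} =
      {(\<one>, x), (x, \<one>), (\<one>, x \<otimes> y), (x \<otimes> y, \<one>), (x, x \<otimes> y), (x \<otimes> y, x)}"
    using ne by auto
  have "x \<otimes> inv (x \<otimes> y) = inv y" "x \<otimes> y \<otimes> inv x = y"
    using assms(1,2) by (simp_all add: inv_mult m_assoc[symmetric]) (simp add: m_comm[of x y] m_assoc)
  then show "differences G {\<one>, x, x \<otimes> y} = {#x, y, z, inv x, inv y, inv z#}"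
    unfolding differences_def pairs using ne assms(1-3) z1 z2 by simp
  show "is_triple G {\<one>, x, x \<otimes> y}"
    unfolding is_triple_def using ne assms by auto
qed

text \<open>The multiset of all signed components contains \<open>X\<close> and has at most
  \<open>card X\<close> elements, so the two agree, with every multiplicity equal to one.\<close>

lemma decomposable_difference_triples:
  assumes "comm_group G" "decomposable G X" "\<one>\<^bsub>G\<^esub> \<notin> X"
  shows "\<exists>\<T>. (\<forall>T\<in>\<T>. is_triple G T) \<and> (\<Sum>T\<in>\<T>. differences G T) = mset_set X"
proof -
  interpret comm_group G by fact
  obtain B where B: "finite B" "B \<subseteq> zero_sum_triples G" "X \<subseteq> signed_parts G B" "6 * card B \<le> card X"
    using assms(2) unfolding decomposable_def by blast
  have X: "finite X" using assms(2) unfolding decomposable_def by auto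
  define M where "M = (\<lambda>(x, y, z). {#x, y, z, inv\<^bsub>G\<^esub> x, inv\<^bsub>G\<^esub> y, inv\<^bsub>G\<^esub> z#})"
  define D where "D = (\<lambda>(x, y, z :: 'a). {\<one>\<^bsub>G\<^esub>, x, x \<otimes>\<^bsub>G\<^esub> y})"
  have "mset_set X \<subseteq># (\<Sum>b\<in>B. M b)"
  proof (rule mset_subset_eqI)
    fix a
    show "count (mset_set X) a \<le> count (\<Sum>b\<in>B. M b) a"
    proof (cases "a \<in> X")
      case True
      then obtain b where "b \<in> B" "a \<in># M b"
        using B(3) unfolding signed_parts_def M_def by auto
      then have "a \<in># (\<Sum>b\<in>B. M b)" using B(1) by (auto simp: set_mset_sum)
      then show ?thesis using True X by (simp add: Suc_le_eq)
    qed simp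
  qed
  moreover have "size (\<Sum>b\<in>B. M b) \<le> size (mset_set X)"
  proof -
    have "size (\<Sum>b\<in>B. M b) = (\<Sum>b\<in>B. 6)"
      unfolding size_multiset_sum by (intro sum.cong) (auto simp: M_def)
    then show ?thesis using B(4) by simp
  qed
  ultimately have sumM: "(\<Sum>b\<in>B. M b) = mset_set X"
    by (metis mset_subset_size subset_mset.le_neq_trans not_le)
  \<comment> \<open>As \<open>X\<close> omits the identity, no component of a block is
    \<open>\<one>\<close>, which \<open>differences_triple\<close> requires.\<close>
  have ne: "set_mset (M b) \<subseteq> X" if "b \<in> B" for b
    using that B(1) X set_mset_sum[OF B(1), of M] unfolding sumM by auto
  have D: "differences G (D b) = M b \<and> is_triple G (D b)" if "b \<in> B" for b
  proof -
    obtain x y z where b: "b = (x, y, z)" by (cases b)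
    then show ?thesis
      using that B(2) ne[OF that] assms(3) differences_triple[of x y z]
      unfolding M_def D_def zero_sum_triples_def by auto
  qed
  \<comment> \<open>The difference family is a set, so distinct blocks must give distinct triples.
    Two blocks with the same triple would have the same differences, and some element of
    \<open>X\<close> would be counted twice.\<close>
  have "inj_on D B"
  proof (rule inj_onI, rule ccontr)
    fix b c assume bc: "b \<in> B" "c \<in> B" "D b = D c" "b \<noteq> c"
    then have eq: "M b = M c" using D by metis
    obtain a where a: "a \<in># M b" unfolding M_def by (cases b) auto
    have "(\<Sum>b\<in>{b, c}. count (M b) a) \<le> (\<Sum>b\<in>B. count (M b) a)"
      by (rule sum_mono2) (use bc B(1) in auto)
    also have "\<dots> = count (mset_set X) a" unfolding sumM[symmetric] by (simp add: count_sum)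
    also have "\<dots> \<le> 1" by (metis count_mset_set' le_refl zero_le_one)
    finally show False using bc(4) eq a by (simp add: Suc_le_eq flip: count_greater_zero_iff)
  qed
  then have "(\<Sum>T\<in>D ` B. differences G T) = (\<Sum>b\<in>B. M b)"
    by (subst sum.reindex) (auto intro!: sum.cong simp: D)
  then show ?thesis using sumM D by (intro exI[of _ "D ` B"]) auto
qed

text \<open>The spread consists of \<open>{\<one>, x}\<close> for the involutions \<open>x\<close>
  and of \<open>{\<one>, t, inv t}\<close> for \<open>t \<in> E\<close>. That \<open>E\<close> is
  disjoint from its inverses makes the latter distinct subgroups with three elements.\<close>

lemma pyramidal_imp_difference_family:
  assumes "pyramidal G n m e" "m > 0"
  shows "card (involutions G) = 2 ^ m - 1"
    and "\<exists>\<T>. difference_family_of_type G (replicate_mset (2 ^ m - 1) 2 + replicate_mset e 3) \<T>"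
proof -
  interpret comm_group G using assms(1) unfolding pyramidal_def by blast
  have fin: "finite (carrier G)" using assms(1) unfolding pyramidal_def by blast
  obtain E where E: "E \<subseteq> carrier G" "card E = e"
      "\<And>t. t \<in> E \<Longrightarrow> t \<noteq> \<one>\<^bsub>G\<^esub> \<and> t \<otimes>\<^bsub>G\<^esub> t \<otimes>\<^bsub>G\<^esub> t = \<one>\<^bsub>G\<^esub>" "E \<inter> m_inv G ` E = {}"
      "decomposable G (carrier G - {x. x \<otimes>\<^bsub>G\<^esub> x = \<one>\<^bsub>G\<^esub>} - (E \<union> m_inv G ` E))"
    using assms(1) unfolding pyramidal_def by blast
  have finE: "finite E" using E(1) fin by (rule finite_subset)
  have inv_eq: "involutions G = {x \<in> carrier G. x \<otimes>\<^bsub>G\<^esub> x = \<one>\<^bsub>G\<^esub>} - {\<one>\<^bsub>G\<^esub>}"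
  proof -
    have "ord x = 2 \<longleftrightarrow> x \<otimes>\<^bsub>G\<^esub> x = \<one>\<^bsub>G\<^esub> \<and> x \<noteq> \<one>\<^bsub>G\<^esub>" if x: "x \<in> carrier G" for x
    proof -
      have pow2: "x [^]\<^bsub>G\<^esub> (2::nat) = x \<otimes>\<^bsub>G\<^esub> x" using x by (simp add: numeral_2_eq_2)
      show ?thesis
      proof
        assume o: "ord x = 2"
        then have "x [^]\<^bsub>G\<^esub> (2::nat) = \<one>\<^bsub>G\<^esub>" using pow_ord_eq_1[OF x] by simp
        moreover have "x \<noteq> \<one>\<^bsub>G\<^esub>" using o ord_eq_1[OF x] by auto
        ultimately show "x \<otimes>\<^bsub>G\<^esub> x = \<one>\<^bsub>G\<^esub> \<and> x \<noteq> \<one>\<^bsub>G\<^esub>" using pow2 by simp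
      next
        assume o: "x \<otimes>\<^bsub>G\<^esub> x = \<one>\<^bsub>G\<^esub> \<and> x \<noteq> \<one>\<^bsub>G\<^esub>"
        then have "ord x dvd 2" using pow_eq_id[OF x, of 2] pow2 by simp
        moreover have "ord x \<noteq> 1" using o ord_eq_1[OF x] by auto
        ultimately show "ord x = 2" using two_is_prime_nat by (metis prime_nat_iff)
      qed
    qed
    then show ?thesis unfolding involutions_def by auto
  qed
  have card2: "card {x \<in> carrier G. x \<otimes>\<^bsub>G\<^esub> x = \<one>\<^bsub>G\<^esub>} = 2 ^ m" using assms(1) unfolding pyramidal_def by blast
  then show c: "card (involutions G) = 2 ^ m - 1"
    unfolding inv_eq by (subst card_Diff_singleton) auto
  define S2 where "S2 = (\<lambda>x. {\<one>\<^bsub>G\<^esub>, x}) ` involutions G"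
  define S3 where "S3 = (\<lambda>t. {\<one>\<^bsub>G\<^esub>, t, inv\<^bsub>G\<^esub> t}) ` E"
  have inv2: "inv\<^bsub>G\<^esub> x = x" if "x \<in> involutions G" for x
    using that unfolding inv_eq by (auto intro: inv_equality)
  have sq3: "t \<otimes>\<^bsub>G\<^esub> t = inv\<^bsub>G\<^esub> t" if "t \<in> E" for t
    using E(3)[OF that] that E(1) by (metis inv_equality subsetD m_closed inv_inv)
  have ne3: "inv\<^bsub>G\<^esub> t \<noteq> t" "inv\<^bsub>G\<^esub> t \<noteq> \<one>\<^bsub>G\<^esub>" "t \<noteq> \<one>\<^bsub>G\<^esub>" if "t \<in> E" for t
  proof -
    show "inv\<^bsub>G\<^esub> t \<noteq> t" using that E(4) by (metis IntI empty_iff image_eqI)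
    show "inv\<^bsub>G\<^esub> t \<noteq> \<one>\<^bsub>G\<^esub>" "t \<noteq> \<one>\<^bsub>G\<^esub>"
      using E(3)[OF that] that E(1) by (auto simp: inv_eq_1_iff)
  qed
  have invsq3: "inv\<^bsub>G\<^esub> t \<otimes>\<^bsub>G\<^esub> inv\<^bsub>G\<^esub> t = t" if "t \<in> E" for t
    using sq3[OF that] that E(1) by (metis inv_inv inv_mult subsetD)
  have sub2: "subgroup S G" if "S \<in> S2" for S
    using that inv2 unfolding S2_def by (auto intro!: subgroupI simp: inv_eq)
  have sub3: "subgroup S G" if S: "S \<in> S3" for S
  proof -
    obtain t where t: "t \<in> E" "S = {\<one>\<^bsub>G\<^esub>, t, inv\<^bsub>G\<^esub> t}" using S unfolding S3_def by auto
    have "t \<in> carrier G" using t E(1) by auto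
    then show ?thesis unfolding t(2) using sq3[OF t(1)] invsq3[OF t(1)]
      by (intro subgroupI) auto
  qed
  have card_S2: "card S = 2" if "S \<in> S2" for S
    using that unfolding S2_def inv_eq card_2_iff by blast
  have card_S3: "card S = 3" if "S \<in> S3" for S
    using that ne3 unfolding S3_def by (auto simp: eq_commute)
  have disj: "S2 \<inter> S3 = {}" using card_S2 card_S3 by fastforce
  have inj2: "inj_on (\<lambda>x. {\<one>\<^bsub>G\<^esub>, x}) (involutions G)"
    unfolding inj_on_def inv_eq by (auto simp: doubleton_eq_iff)
  have inj3: "inj_on (\<lambda>t. {\<one>\<^bsub>G\<^esub>, t, inv\<^bsub>G\<^esub> t}) E"
  proof (rule inj_onI)
    fix s t assume st: "s \<in> E" "t \<in> E" "{\<one>\<^bsub>G\<^esub>, s, inv\<^bsub>G\<^esub> s} = {\<one>\<^bsub>G\<^esub>, t, inv\<^bsub>G\<^esub> t}"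
    then have "s = t \<or> s = inv\<^bsub>G\<^esub> t" using ne3[OF st(1)] by blast
    then show "s = t" using E(4) st by blast
  qed
  have finI: "finite (involutions G)" using fin unfolding inv_eq by auto
  have finS: "finite S2" "finite S3" unfolding S2_def S3_def using finI finE by auto
  have "image_mset card (mset_set (S2 \<union> S3)) = image_mset (\<lambda>_. 2) (mset_set S2) + image_mset (\<lambda>_. 3) (mset_set S3)"
    using finS disj card_S2 card_S3
    by (simp add: mset_set_Union) (metis (no_types, lifting) elem_mset_set image_mset_cong)
  also have "\<dots> = replicate_mset (2 ^ m - 1) 2 + replicate_mset e 3"
    using card_image[OF inj2] card_image[OF inj3] c E(2)
    unfolding S2_def[symmetric] S3_def[symmetric] by (simp add: image_mset_const_eq)
  finally have type: "image_mset card (mset_set (S2 \<union> S3)) = replicate_mset (2 ^ m - 1) 2 + replicate_mset e 3" .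
  have "pairwise (\<lambda>S S'. S \<inter> S' = {\<one>\<^bsub>G\<^esub>}) (S2 \<union> S3)"
  proof (rule pairwiseI)
    fix S S' assume S: "S \<in> S2 \<union> S3" "S' \<in> S2 \<union> S3" "S \<noteq> S'"
    have aux: "S \<inter> S' = {\<one>\<^bsub>G\<^esub>}" if SS: "S \<in> S2" "S' \<in> S3" for S S'
    proof -
      obtain x t where xt: "x \<in> involutions G" "t \<in> E" "S = {\<one>\<^bsub>G\<^esub>, x}" "S' = {\<one>\<^bsub>G\<^esub>, t, inv\<^bsub>G\<^esub> t}"
        using SS unfolding S2_def S3_def by auto
      have "t \<in> carrier G" using xt E(1) by auto
      then have "x \<noteq> t" "x \<noteq> inv\<^bsub>G\<^esub> t" using inv2[OF xt(1)] ne3[OF xt(2)] by (auto simp: inv_inv)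
      then show ?thesis using xt by auto
    qed
    have aux3: "S \<inter> S' = {\<one>\<^bsub>G\<^esub>}" if SS: "S \<in> S3" "S' \<in> S3" "S \<noteq> S'" for S S'
    proof -
      obtain s t where st: "s \<in> E" "t \<in> E" "S = {\<one>\<^bsub>G\<^esub>, s, inv\<^bsub>G\<^esub> s}" "S' = {\<one>\<^bsub>G\<^esub>, t, inv\<^bsub>G\<^esub> t}"
        using SS unfolding S3_def by auto
      have "s \<in> carrier G" "t \<in> carrier G" using st E(1) by auto
      moreover have "s \<noteq> t" using st SS by auto
      moreover have "s \<noteq> inv\<^bsub>G\<^esub> t" "t \<noteq> inv\<^bsub>G\<^esub> s" using E(4) st by blast+
      ultimately have "{s, inv\<^bsub>G\<^esub> s} \<inter> {t, inv\<^bsub>G\<^esub> t} = {}" using inv_inv by (metis Int_emptyI empty_iff insert_iff)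
      then show ?thesis unfolding st using ne3[OF st(1)] ne3[OF st(2)] by auto
    qed
    have aux2: "S \<inter> S' = {\<one>\<^bsub>G\<^esub>}" if "S \<in> S2" "S' \<in> S2" "S \<noteq> S'" for S S'
      using that unfolding S2_def by auto
    show "S \<inter> S' = {\<one>\<^bsub>G\<^esub>}"
      using S aux[of S S'] aux[of S' S] aux2[of S S'] aux3[of S S'] by (auto simp: Int_commute)
  qed
  then have spread: "partial_spread_of_type G (replicate_mset (2 ^ m - 1) 2 + replicate_mset e 3) (S2 \<union> S3)"
    unfolding partial_spread_of_type_def partial_spread_def using sub2 sub3 type by blast
  \<comment> \<open>One member of the spread must exist for its union to contain the identity;
    \<open>m > 0\<close> provides an involution.\<close>
  have "involutions G \<noteq> {}"
  proof
    assume "involutions G = {}"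
    then have "(2::nat) ^ m - 1 = 0" using c by simp
    then show False using one_less_power[of "2::nat" m] assms(2) by linarith
  qed
  then have "\<one>\<^bsub>G\<^esub> \<in> \<Union>(S2 \<union> S3)" unfolding S2_def by auto
  then have "\<Union>(S2 \<union> S3) = {x \<in> carrier G. x \<otimes>\<^bsub>G\<^esub> x = \<one>\<^bsub>G\<^esub>} \<union> (E \<union> m_inv G ` E)"
    unfolding S2_def S3_def inv_eq by auto
  then have U: "carrier G - \<Union>(S2 \<union> S3) = carrier G - {x. x \<otimes>\<^bsub>G\<^esub> x = \<one>\<^bsub>G\<^esub>} - (E \<union> m_inv G ` E)"
    by blast
  have "\<exists>\<T>. (\<forall>T\<in>\<T>. is_triple G T) \<and> (\<Sum>T\<in>\<T>. differences G T) = mset_set (carrier G - \<Union>(S2 \<union> S3))"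
    unfolding U by (rule decomposable_difference_triples[OF _ E(5)]) (auto intro: comm_group_axioms)
  then show "\<exists>\<T>. difference_family_of_type G (replicate_mset (2 ^ m - 1) 2 + replicate_mset e 3) \<T>"
    unfolding difference_family_of_type_def difference_family_def using spread by blast
qed

section \<open>Adding a Klein four-group\<close>

abbreviation Z :: "nat \<Rightarrow> int monoid" where "Z \<equiv> integer_mod_group"

lemma int_atLeastLessThan_simps:
  "{0..<1::int} = {0}" "{0..<2::int} = {0, 1}" "{0..<3::int} = {0, 1, 2}" "{0..<4::int} = {0, 1, 2, 3}"
  by auto

lemmas Z_simps = carrier_integer_mod_group order_def zero_sum_triples_def card_cartesian_product
  int_atLeastLessThan_simps

lemma has_complete_mapping_by_list:
  assumes "finite (carrier G)" "length ts \<le> order G" "set ts \<subseteq> zero_sum_triples G"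
    "\<forall>w\<in>carrier G. w \<in> set (map fst ts) \<and> w \<in> set (map (fst \<circ> snd) ts) \<and> w \<in> set (map (snd \<circ> snd) ts)"
  shows "has_complete_mapping G"
proof -
  have "card (set ts) \<le> order G" using assms(2) card_length[of ts] by linarith
  moreover have "(\<exists>y z. (w, y, z) \<in> set ts) \<and> (\<exists>x z. (x, w, z) \<in> set ts) \<and> (\<exists>x y. (x, y, w) \<in> set ts)"
    if "w \<in> carrier G" for w
    using bspec[OF assms(4) that] by (force simp: image_iff)
  ultimately show ?thesis
    unfolding has_complete_mapping_def using assms(1,3) by blast
qed

text \<open>In the field with four elements these are the triples
  \<open>(w, \<omega> * w, \<omega>^2 * w)\<close> for a primitive cube root of unity
  \<open>\<omega>\<close>, as \<open>1 + \<omega> + \<omega>^2 = 0\<close>.\<close>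

lemma has_complete_mapping_2_2: "has_complete_mapping (Z 2 \<times>\<times> Z 2)"
  by (rule has_complete_mapping_by_list[where ts =
        "[((0, 0), (0, 0), (0, 0)), ((0, 1), (1, 0), (1, 1)), ((1, 0), (1, 1), (0, 1)), ((1, 1), (0, 1), (1, 0))]"])
     (simp_all add: Z_simps)

lemma Times_Diff_split:
  assumes "F \<subseteq> C" "F \<inter> I = {}" "k \<in> K"
  shows "C \<times> K - I \<times> K - F \<times> {k} = (C - I - F) \<times> K \<union> F \<times> (K - {k})"
  using assms by blast

text \<open>Elements of \<open>?K\<close> square to the identity, so the elements of square
  \<open>\<one>\<close> become four times as many, and \<open>E\<close> is placed over
  \<open>(0, 0)\<close>. The complete mapping lifts the old decomposition; what remains are the
  elements over \<open>E\<close> and its inverses whose second coordinate is nonzero.\<close>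

lemma pyramidal_times_2_2:
  assumes "pyramidal G n m e"
  shows "pyramidal (G \<times>\<times> (Z 2 \<times>\<times> Z 2)) (4 * n) (m + 2) e"
proof -
  let ?K = "Z 2 \<times>\<times> Z 2"
  let ?H = "G \<times>\<times> ?K"
  interpret G: comm_group G using assms unfolding pyramidal_def by blast
  have K: "comm_group ?K" by (simp add: comm_group_DirProd)
  then have grpK: "group ?K" by (simp add: comm_group.axioms)
  interpret H: comm_group ?H by (rule comm_group_DirProd[OF G.comm_group_axioms K])
  have fin: "finite (carrier G)" and ord: "order G = n"
    and card2: "card {x \<in> carrier G. x \<otimes>\<^bsub>G\<^esub> x = \<one>\<^bsub>G\<^esub>} = 2 ^ m"
    using assms unfolding pyramidal_def by blast+
  obtain E where E: "E \<subseteq> carrier G" "card E = e"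
      "\<And>t. t \<in> E \<Longrightarrow> t \<noteq> \<one>\<^bsub>G\<^esub> \<and> t \<otimes>\<^bsub>G\<^esub> t \<otimes>\<^bsub>G\<^esub> t = \<one>\<^bsub>G\<^esub>" "E \<inter> m_inv G ` E = {}"
      "decomposable G (carrier G - {x. x \<otimes>\<^bsub>G\<^esub> x = \<one>\<^bsub>G\<^esub>} - (E \<union> m_inv G ` E))"
    using assms unfolding pyramidal_def by blast
  let ?X = "carrier G - {x. x \<otimes>\<^bsub>G\<^esub> x = \<one>\<^bsub>G\<^esub>} - (E \<union> m_inv G ` E)"
  have finE: "finite E" using E(1) fin by (rule finite_subset)
  have inv_sub: "m_inv G ` E \<subseteq> carrier G" using E(1) by auto
  have carK: "carrier ?K = {(0, 0), (0, 1), (1, 0), (1, 1)}"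
    by (auto simp: Z_simps)
  have sqK: "k \<otimes>\<^bsub>?K\<^esub> k = (0, 0)" if "k \<in> carrier ?K" for k
    using that unfolding carK by auto
  have invK: "inv\<^bsub>?K\<^esub> k = k" if "k \<in> carrier ?K" for k
    using that sqK[OF that] by (intro group.inv_equality[OF grpK]) auto
  have inv_H: "inv\<^bsub>?H\<^esub> (x, k) = (inv\<^bsub>G\<^esub> x, k)" if "x \<in> carrier G" "k \<in> carrier ?K" for x k
    using inv_DirProd[OF G.is_group grpK that] invK[OF that(2)] by simp
  have I: "{x \<in> carrier ?H. x \<otimes>\<^bsub>?H\<^esub> x = \<one>\<^bsub>?H\<^esub>} = {x \<in> carrier G. x \<otimes>\<^bsub>G\<^esub> x = \<one>\<^bsub>G\<^esub>} \<times> carrier ?K"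
    using sqK by (auto simp: mult_DirProd')
  let ?E = "(\<lambda>t. (t, (0::int, 0::int))) ` E"
  have invE: "m_inv ?H ` ?E = (\<lambda>t. (t, (0, 0))) ` m_inv G ` E"
    unfolding image_image using E(1) inv_H carK by (intro image_cong) auto
  have split: "carrier ?H - {x. x \<otimes>\<^bsub>?H\<^esub> x = \<one>\<^bsub>?H\<^esub>} - (?E \<union> m_inv ?H ` ?E) =
      ?X \<times> carrier ?K \<union> (E \<union> m_inv G ` E) \<times> {(0, 1), (1, 0), (1, 1)}" (is "?L = ?R")
  proof -
    \<comment> \<open>Elements of order 3 do not square to the identity;
      \<open>Times_Diff_split\<close> needs this disjointness.\<close>
    have "x \<in> carrier G \<and> x \<otimes>\<^bsub>G\<^esub> x \<noteq> \<one>\<^bsub>G\<^esub>" if x: "x \<in> E \<union> m_inv G ` E" for x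
    proof -
      obtain t where t: "t \<in> E" "x = t \<or> x = inv\<^bsub>G\<^esub> t" using x by auto
      have "t \<in> carrier G" using t E(1) by auto
      moreover have "t \<otimes>\<^bsub>G\<^esub> t \<noteq> \<one>\<^bsub>G\<^esub>" using E(3)[OF t(1)] calculation by auto
      ultimately show ?thesis using t(2) by (metis G.inv_closed G.inv_inv G.inv_mult G.inv_one)
    qed
    note E' = this
    have "?L = carrier ?H - {x \<in> carrier ?H. x \<otimes>\<^bsub>?H\<^esub> x = \<one>\<^bsub>?H\<^esub>} - (E \<union> m_inv G ` E) \<times> {(0, 0)}"
      unfolding invE by auto
    also have "\<dots> = (carrier G - {x \<in> carrier G. x \<otimes>\<^bsub>G\<^esub> x = \<one>\<^bsub>G\<^esub>} - (E \<union> m_inv G ` E)) \<times> carrier ?K \<union>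
        (E \<union> m_inv G ` E) \<times> (carrier ?K - {(0, 0)})"
      unfolding I unfolding carrier_DirProd[of G ?K] by (rule Times_Diff_split) (use E' carK in auto)
    also have "\<dots> = ?R" unfolding carK by auto
    finally show ?thesis .
  qed
  have d1: "decomposable ?H (?X \<times> carrier ?K)"
    by (rule decomposable_DirProd[OF G.is_group grpK E(5) has_complete_mapping_2_2])
  have d2: "decomposable ?H ((E \<union> m_inv G ` E) \<times> {(0, 1), (1, 0), (1, 1)})"
    (is "decomposable ?H ?Y")
  proof -
    \<comment> \<open>The first coordinates cancel because \<open>t\<close> has order 3, the second
      ones because the three nonzero elements of \<open>?K\<close> have sum zero.\<close>
    let ?B = "(\<lambda>t. ((t, 0::int, 1::int), (t, 1, 0), (t, 1, 1))) ` E"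
    have "?B \<subseteq> zero_sum_triples ?H"
      using E(1,3) by (auto simp: Z_simps subset_iff)
    moreover have "?Y \<subseteq> signed_parts ?H ?B"
    proof clarify
      fix x :: 'a and a b :: int assume x: "x \<in> E \<union> m_inv G ` E" and k: "(a, b) \<in> {(0, 1), (1, 0), (1, 1)}"
      obtain t where t: "t \<in> E" "x = t \<or> x = inv\<^bsub>G\<^esub> t" using x by auto
      have "{(t, 0, 1), (t, 1, 0), (t, 1, 1), inv\<^bsub>?H\<^esub> (t, 0, 1), inv\<^bsub>?H\<^esub> (t, 1, 0), inv\<^bsub>?H\<^esub> (t, 1, 1)}
          \<subseteq> signed_parts ?H ?B"
        by (rule signed_partsI) (use t(1) in auto)
      moreover have "t \<in> carrier G" using t E(1) by auto
      ultimately show "(x, a, b) \<in> signed_parts ?H ?B"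
        using t(2) k inv_H[of t] unfolding carK by auto
    qed
    moreover have "6 * card ?B \<le> card ?Y"
    proof -
      have "card (m_inv G ` E) = card E"
        using E(1) by (intro card_image inj_on_inverseI[where g = "m_inv G"]) auto
      then have "card (E \<union> m_inv G ` E) = 2 * card E"
        using E(4) finE by (simp add: card_Un_disjoint)
      then have "card ?Y = 6 * card E" unfolding card_cartesian_product by simp
      then show ?thesis using card_image_le[OF finE] by simp
    qed
    ultimately show ?thesis
      unfolding decomposable_def using finE E(1) inv_sub carK
      by (intro conjI exI[of _ ?B]) auto
  qed
  have dec: "decomposable ?H (carrier ?H - {x. x \<otimes>\<^bsub>?H\<^esub> x = \<one>\<^bsub>?H\<^esub>} - (?E \<union> m_inv ?H ` ?E))"
    unfolding split by (rule decomposable_Un[OF d1 d2]) blast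
  have "card ?E = e" using E(2) by (subst card_image) (auto simp: inj_on_def)
  moreover have "\<forall>t\<in>?E. t \<noteq> \<one>\<^bsub>?H\<^esub> \<and> t \<otimes>\<^bsub>?H\<^esub> t \<otimes>\<^bsub>?H\<^esub> t = \<one>\<^bsub>?H\<^esub>"
    using E(3) by auto
  moreover have "?E \<inter> m_inv ?H ` ?E = {}" unfolding invE using E(4) by auto
  moreover have "?E \<subseteq> carrier ?H" using E(1) carK by auto
  moreover have "card {x \<in> carrier ?H. x \<otimes>\<^bsub>?H\<^esub> x = \<one>\<^bsub>?H\<^esub>} = 2 ^ (m + 2)"
    unfolding I card_cartesian_product card2 carK by simp
  moreover have "order ?H = 4 * n"
    using ord unfolding order_def carrier_DirProd[of G ?K] carK card_cartesian_product by simp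
  moreover have "finite (carrier ?H)" using fin carK by simp
  ultimately show ?thesis
    unfolding pyramidal_def using dec H.comm_group_axioms by blast
qed

text \<open>Forming a product changes the type, so each induction step returns to \<open>nat\<close>
  through \<open>pyramidal_nat\<close>.\<close>

lemma pyramidal_times_2_power:
  fixes G :: "nat monoid"
  assumes "pyramidal G n m e"
  shows "\<exists>H :: nat monoid. pyramidal H (4 ^ j * n) (m + 2 * j) e"
proof (induction j)
  case 0
  then show ?case using assms by auto
next
  case (Suc j)
  then obtain H :: "nat monoid" where "pyramidal H (4 ^ j * n) (m + 2 * j) e" by blast
  from pyramidal_nat[OF pyramidal_times_2_2[OF this]] show ?case by (simp add: mult_ac)
qed

section \<open>Reductions for cyclic factors\<close>

lemma carrier_Z: "n > 0 \<Longrightarrow> carrier (Z n) = {0..<int n}"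
  by (simp add: carrier_integer_mod_group)

lemma inv_Z: "x \<in> carrier (Z n) \<Longrightarrow> x \<noteq> 0 \<Longrightarrow> n > 0 \<Longrightarrow> inv\<^bsub>Z n\<^esub> x = int n - x"
  by (simp add: carrier_Z zmod_zminus1_eq_if)

text \<open>One of \<open>t\<close> and \<open>t + n\<close> is even and can be halved. This
  supplies the hypothesis \<open>half\<close> of the next lemma.\<close>

lemma ex_half_Z:
  assumes "odd n" "t \<in> carrier (Z n)"
  shows "\<exists>s\<in>carrier (Z n). t = s \<otimes>\<^bsub>Z n\<^esub> s"
proof (cases "even t")
  case True
  then show ?thesis
    using assms by (intro bexI[of _ "t div 2"]) (auto simp: carrier_Z odd_pos elim!: evenE)
next
  case False
  then have "t + int n = 2 * ((t + int n) div 2)" using assms(1) by simp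
  then have "t = ((t + int n) div 2 + (t + int n) div 2) mod int n"
    using assms by (simp add: carrier_Z odd_pos mult_2[symmetric])
  then show ?thesis
    using assms by (intro bexI[of _ "(t + int n) div 2"]) (auto simp: carrier_Z odd_pos)
qed

text \<open>With \<open>a = 4 * j + 1\<close>, the components \<open>a\<close> and
  \<open>a + 4 * M\<close> run through the residues 1 modulo 4, and their negatives through those 3
  modulo 4. The third component \<open>-(2 * a + 4 * M)\<close> and its negative cover the residues
  2 modulo 4. Over \<open>D\<close> the coordinates are \<open>t, t, -2t\<close>, so every element
  of \<open>D\<close> must be a double.\<close>

lemma decomposable_not_div_4:
  fixes D :: "'a monoid" and M :: nat
  assumes "comm_group D" "finite (carrier D)" "M > 0"
    and half: "\<And>t. t \<in> carrier D \<Longrightarrow> \<exists>s\<in>carrier D. t = s \<otimes>\<^bsub>D\<^esub> s"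
  shows "decomposable (D \<times>\<times> Z (8 * M)) (carrier D \<times> {a \<in> {0..<int (8 * M)}. a mod 4 \<noteq> 0})"
    (is "decomposable ?G (_ \<times> ?A)")
proof -
  interpret D: comm_group D by fact
  interpret G: comm_group ?G using assms by (simp add: comm_group_DirProd)
  have finA: "finite ?A" by (rule finite_subset[of _ "{0..<int (8 * M)}"]) auto
  define tri where "tri = (\<lambda>(t, j :: int). ((t, 4 * j + 1), (t, 4 * j + 1 + 4 * int M),
     (inv\<^bsub>D\<^esub> (t \<otimes>\<^bsub>D\<^esub> t), (- (8 * j + 2 + 4 * int M)) mod (8 * int M))))"
  define B where "B = tri ` (carrier D \<times> {0..<int M})"
  have B: "B \<subseteq> zero_sum_triples ?G"
    unfolding B_def tri_def zero_sum_triples_def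
    using assms(3) by (auto simp: carrier_Z mod_simps)
  have inv_G: "inv\<^bsub>?G\<^esub> (t, a) = (inv\<^bsub>D\<^esub> t, int (8 * M) - a)" if "t \<in> carrier D" "0 < a" "a < int (8 * M)" for t a
    using that inv_Z[of a "8 * M"] assms(3) by (simp add: carrier_Z)
  have c1: "(t, a) \<in> signed_parts ?G B" if t: "t \<in> carrier D" and a: "0 \<le> a" "a < int (8 * M)" "a mod 4 = 1" for t a
  \<comment> \<open>Below \<open>4 * M\<close> the residue is the first component of a block, from
    there on the second.\<close>
  proof (cases "a < 4 * int M")
    case True
    have "tri (t, a div 4) \<in> B" unfolding B_def by (intro imageI) (use t a True in auto)
    moreover have "4 * (a div 4) + 1 = a" using a(3) by presburger
    ultimately show ?thesis using signed_partsI unfolding tri_def by fastforce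
  next
    case False
    have "tri (t, a div 4 - int M) \<in> B" unfolding B_def by (intro imageI) (use t a False in auto)
    moreover have "4 * (a div 4 - int M) + 1 + 4 * int M = a" using a(3) by presburger
    ultimately show ?thesis using signed_partsI unfolding tri_def by fastforce
  qed
  have c2: "(t, a) \<in> signed_parts ?G B"
    if t: "t \<in> carrier D" and a: "0 \<le> a" "a < int (8 * M)" "a mod 8 = (2 + 4 * int M) mod 8" for t a
  proof -
    obtain s where s: "s \<in> carrier D" "t = s \<otimes>\<^bsub>D\<^esub> s" using half[OF t] by blast
    \<comment> \<open>\<open>b\<close> is the multiple of 8 with \<open>b + 2 + 4 * M\<close>
      congruent to \<open>a\<close> modulo \<open>8 * M\<close>; one eighth of it is the index of
      the block whose third component is the inverse of \<open>(t, a)\<close>.\<close>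
    define b where "b = (a - 2 - 4 * int M) mod (8 * int M)"
    have "8 dvd (a - 2 - 4 * int M)"
      using a(3) by (simp add: mod_eq_dvd_iff diff_diff_eq)
    then have "8 dvd b" unfolding b_def by (simp add: dvd_mod_iff)
    then obtain j where j: "b = 8 * j" by blast
    have "0 \<le> b" "b < 8 * int M" unfolding b_def using assms(3) by auto
    then have tri: "tri (s, j) \<in> B" unfolding B_def using s j by auto
    define y where "y = 8 * j + 2 + 4 * int M"
    have "inv\<^bsub>?G\<^esub> (inv\<^bsub>D\<^esub> (s \<otimes>\<^bsub>D\<^esub> s), (- y) mod (8 * int M)) \<in> signed_parts ?G B"
      using signed_partsI tri unfolding tri_def y_def by fastforce
    moreover have "inv\<^bsub>?G\<^esub> (inv\<^bsub>D\<^esub> (s \<otimes>\<^bsub>D\<^esub> s), (- y) mod (8 * int M)) = (s \<otimes>\<^bsub>D\<^esub> s, y mod (8 * int M))"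
      using s assms(3) by (simp add: carrier_Z mod_simps)
    moreover have "y mod (8 * int M) = a"
    proof -
      have "y mod (8 * int M) = ((a - 2 - 4 * int M) + (2 + 4 * int M)) mod (8 * int M)"
        unfolding y_def j[symmetric] b_def add.assoc by (rule mod_add_left_eq)
      then show ?thesis using a by simp
    qed
    ultimately show ?thesis using s by simp
  qed
  have neg: "(t, a) \<in> signed_parts ?G B"
    if "(inv\<^bsub>D\<^esub> t, int (8 * M) - a) \<in> signed_parts ?G B" "t \<in> carrier D" "0 < a" "a < int (8 * M)" for t a
    using G.signed_parts_inv[OF B that(1)] that inv_G[of "inv\<^bsub>D\<^esub> t" "int (8 * M) - a"] by simp
  have "carrier D \<times> ?A \<subseteq> signed_parts ?G B"
  proof clarify
    fix t a assume t: "t \<in> carrier D" and a: "a \<in> {0..<int (8 * M)}" "a mod 4 \<noteq> 0"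
    have a0: "0 < a" "a < int (8 * M)" using a by (auto simp: order_le_less)
    have "a mod 4 = 1 \<or> a mod 4 = 3 \<or> a mod 8 = 2 \<or> a mod 8 = 6" using a(2) by presburger
    moreover have "(2 + 4 * int M) mod 8 = 2 \<or> (2 + 4 * int M) mod 8 = 6" by presburger
    moreover have "a mod 8 = 2 \<Longrightarrow> (8 * int M - a) mod 8 = 6" "a mod 8 = 6 \<Longrightarrow> (8 * int M - a) mod 8 = 2"
      by presburger+
    ultimately consider "a mod 4 = 1" | "a mod 4 = 3" | "a mod 8 = (2 + 4 * int M) mod 8"
      | "(int (8 * M) - a) mod 8 = (2 + 4 * int M) mod 8" by auto
    then show "(t, a) \<in> signed_parts ?G B"
    proof cases
      case 1
      then show ?thesis using a0 by (intro c1[OF t]) auto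
    next
      case 2
      then have "(int (8 * M) - a) mod 4 = 1" by (simp; presburger)
      then show ?thesis using a0 t by (intro neg[OF c1]) auto
    next
      case 3
      then show ?thesis using a0 by (intro c2[OF t]) auto
    next
      case 4
      then show ?thesis using a0 t by (intro neg[OF c2]) auto
    qed
  qed
  moreover have "6 * card B \<le> card (carrier D \<times> ?A)"
  proof -
    \<comment> \<open>Quotient \<open>q\<close> and nonzero remainder \<open>r\<close> on division
      by 4 give \<open>6 * M\<close> elements of \<open>?A\<close>; this lower bound is all the
      count requires.\<close>
    have "(\<lambda>(q, r). 4 * q + r) ` ({0..<2 * int M} \<times> {1, 2, 3}) \<subseteq> ?A"
      by (auto; presburger)
    moreover have "inj_on (\<lambda>(q, r). 4 * q + r) ({0..<2 * int M} \<times> {1, 2, 3 :: int})"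
      by (auto simp: inj_on_def; presburger)
    ultimately have "card ({0..<2 * int M} \<times> {1, 2, 3 :: int}) \<le> card ?A"
      by (intro card_inj_on_le[where f = "\<lambda>(q, r). 4 * q + r"] finA)
    then have "6 * M \<le> card ?A" by (simp add: card_cartesian_product)
    moreover have "card B \<le> card (carrier D) * M"
      unfolding B_def using card_image_le[of "carrier D \<times> {0..<int M}" tri] assms(2)
      by (simp add: card_cartesian_product)
    ultimately have "6 * card B \<le> card (carrier D) * (6 * M)" by simp
    also have "\<dots> \<le> card (carrier D) * card ?A" using \<open>6 * M \<le> card ?A\<close> by (rule mult_le_mono2)
    finally show ?thesis by (simp add: card_cartesian_product)
  qed
  moreover have "finite B" unfolding B_def using assms(2) by simp
  moreover have "carrier D \<times> ?A \<subseteq> carrier ?G" using assms(3) by (auto simp: carrier_Z)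
  moreover have "finite (carrier D \<times> ?A)" using assms(2) finA by (rule finite_cartesian_product)
  ultimately show ?thesis unfolding decomposable_def using B by blast
qed

text \<open>Write \<open>k = 2 * n + 1\<close> and take the blocks for
  \<open>1 \<le> i \<le> n\<close>. Negation exchanges the classes 1 and 2 of \<open>Z 3\<close>, so
  the first two components and their negatives fill both classes. As \<open>k\<close> is odd,
  \<open>2 * i\<close> reaches every nonzero residue up to sign. The count is
  \<open>6 * n = 3 * (k - 1)\<close>.\<close>

lemma decomposable_3_odd:
  fixes k :: nat
  assumes "odd k"
  shows "decomposable (Z 3 \<times>\<times> Z k) ({0, 1, 2} \<times> {1..<int k})" (is "decomposable ?G ?X")
proof -
  obtain n where k: "k = 2 * n + 1" using assms by (auto elim!: oddE)
  interpret G: comm_group ?G by (simp add: comm_group_DirProd)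
  define tri where "tri = (\<lambda>i. ((1 :: int, i), (2 :: int, i), (0 :: int, int k - 2 * i)))"
  define B where "B = tri ` {1..int n}"
  have B: "B \<subseteq> zero_sum_triples ?G"
    unfolding B_def tri_def zero_sum_triples_def by (auto simp: carrier_Z k mod_simps)
  have neg: "(c, i) \<in> signed_parts ?G B"
    if "((- c) mod 3, int k - i) \<in> signed_parts ?G B" "c \<in> {0, 1, 2}" "1 \<le> i" "i < int k" for c i
    using G.signed_parts_inv[OF B that(1)] that by (auto simp: carrier_Z k zmod_zminus1_eq_if)
  have pos: "(1, i) \<in> signed_parts ?G B \<and> (2, i) \<in> signed_parts ?G B \<and> (0, int k - 2 * i) \<in> signed_parts ?G B"
    if "1 \<le> i" "i \<le> int n" for i
  proof -
    have "tri i \<in> B" unfolding B_def using that by auto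
    then show ?thesis using signed_partsI unfolding tri_def by fastforce
  qed
  have "?X \<subseteq> signed_parts ?G B"
  proof clarify
    fix c i :: int assume c: "c \<in> {0, 1, 2}" and i: "i \<in> {1..<int k}"
    show "(c, i) \<in> signed_parts ?G B"
    proof (cases "c = 0")
      case True
      show ?thesis
      \<comment> \<open>The blocks contain \<open>k - 2 * j\<close>, which is odd: an odd
        \<open>i\<close> occurs itself, an even one as the negative of such an element.\<close>
      proof (cases "even i")
        case even: True
        then have "(0, int k - 2 * (i div 2)) \<in> signed_parts ?G B" using i k by (intro pos[THEN conjunct2, THEN conjunct2]) auto
        then show ?thesis using even neg[of 0 i] i True by simp
      next
        case False
        then have "even (int k - i)" using assms by simp
        then obtain j where j: "int k - i = 2 * j" by (rule evenE)
        then have "1 \<le> j" "j \<le> int n" using i k by auto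
        then show ?thesis using True pos[of j] j[symmetric] by simp
      qed
    next
      case False
      then have c: "c = 1 \<or> c = 2" using c by auto
      show ?thesis
      proof (cases "i \<le> int n")
        case True
        then show ?thesis using pos[of i] c i by auto
      next
        case False
        then have "1 \<le> int k - i" "int k - i \<le> int n" using i k by auto
        from pos[OF this] show ?thesis using c i neg[of c i] by auto
      qed
    qed
  qed
  moreover have "6 * card B \<le> card ?X"
    unfolding B_def using card_image_le[of "{1..int n}" tri] by (simp add: card_cartesian_product k)
  moreover have "?X \<subseteq> carrier ?G" by (auto simp: carrier_Z k)
  ultimately show ?thesis unfolding decomposable_def using B by (auto simp: B_def)
qed

section \<open>Explicit solutions in small groups\<close>

text \<open>Here \<open>cs\<close> and \<open>fs\<close> enumerate the carrier and the excluded set,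
  and \<open>neg\<close> is a computable inverse, so that \<open>cover\<close> can be settled by
  evaluation. Lengths bound cardinalities from above, which is the direction needed for both
  \<open>ts\<close> and \<open>fs\<close>.\<close>

lemma decomposable_by_list:
  assumes "group G" "carrier G = set cs" "set ts \<subseteq> zero_sum_triples G"
    "F = set fs" "F \<subseteq> carrier G" "6 * length ts + length fs \<le> order G"
    "\<And>x. x \<in> carrier G \<Longrightarrow> inv\<^bsub>G\<^esub> x = neg x"
    and cover: "let ps = map fst ts @ map (fst \<circ> snd) ts @ map (snd \<circ> snd) ts in
      list_all (\<lambda>x. x \<in> set fs \<or> x \<in> set ps \<or> neg x \<in> set ps) cs"
  shows "decomposable G (carrier G - F)"
proof -
  interpret group G by fact
  define ps where "ps = map fst ts @ map (fst \<circ> snd) ts @ map (snd \<circ> snd) ts"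
  have fin: "finite (carrier G)" unfolding assms(2) by simp
  have pos: "x \<in> signed_parts G (set ts)" if "x \<in> set ps" for x
    using that unfolding signed_parts_def ps_def by force
  have "x \<in> signed_parts G (set ts)" if x: "x \<in> carrier G - F" for x
  proof -
    have "x \<in> set ps \<or> inv\<^bsub>G\<^esub> x \<in> set ps"
      using cover x assms(2,4,7) unfolding ps_def[symmetric] Let_def list_all_iff by force
    then show ?thesis
      using pos signed_parts_inv[OF assms(3)] inv_inv x by (metis DiffD1)
  qed
  moreover have "card F \<le> length fs" unfolding assms(4) by (rule card_length)
  then have "6 * card (set ts) \<le> card (carrier G - F)"
    using card_length[of ts] \<open>card F \<le> length fs\<close> assms(6)
      card_Diff_subset[OF finite_subset[OF assms(5) fin] assms(5)]
    unfolding order_def by linarith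
  ultimately show ?thesis
    unfolding decomposable_def using fin assms(3) by (intro conjI exI[of _ "set ts"]) auto
qed

section \<open>Complete mappings of small 2-groups\<close>

lemma has_complete_mapping_2_2_2: "has_complete_mapping (Z 2 \<times>\<times> Z 2 \<times>\<times> Z 2)"
  by (rule has_complete_mapping_by_list[where ts =
       "[((0, 0, 0), (0, 1, 1), (0, 1, 1)), ((0, 0, 1), (1, 0, 0), (1, 0, 1)),
         ((0, 1, 0), (1, 1, 0), (1, 0, 0)), ((0, 1, 1), (0, 0, 1), (0, 1, 0)),
         ((1, 0, 0), (1, 0, 1), (0, 0, 1)), ((1, 0, 1), (0, 1, 0), (1, 1, 1)),
         ((1, 1, 0), (0, 0, 0), (1, 1, 0)), ((1, 1, 1), (1, 1, 1), (0, 0, 0))]"])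
     (simp_all add: Z_simps)

text \<open>Summing a complete mapping shows that three times the sum of all group elements
  vanishes. The tables respect this: in each of these noncyclic 2-groups the elements have sum
  zero.\<close>

lemma has_complete_mapping_2_2_2_2: "has_complete_mapping (Z 2 \<times>\<times> Z 2 \<times>\<times> Z 2 \<times>\<times> Z 2)"
  by (rule has_complete_mapping_by_list[where ts =
       "[((0, 0, 0, 0), (0, 0, 1, 0), (0, 0, 1, 0)), ((0, 0, 0, 1), (0, 1, 0, 0), (0, 1, 0, 1)),
         ((0, 0, 1, 0), (1, 0, 1, 1), (1, 0, 0, 1)), ((0, 0, 1, 1), (1, 1, 0, 0), (1, 1, 1, 1)),
         ((0, 1, 0, 0), (0, 0, 0, 0), (0, 1, 0, 0)), ((0, 1, 0, 1), (1, 1, 1, 0), (1, 0, 1, 1)),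
         ((0, 1, 1, 0), (0, 0, 0, 1), (0, 1, 1, 1)), ((0, 1, 1, 1), (1, 1, 1, 1), (1, 0, 0, 0)),
         ((1, 0, 0, 0), (1, 0, 0, 1), (0, 0, 0, 1)), ((1, 0, 0, 1), (1, 0, 1, 0), (0, 0, 1, 1)),
         ((1, 0, 1, 0), (0, 1, 1, 1), (1, 1, 0, 1)), ((1, 0, 1, 1), (0, 1, 0, 1), (1, 1, 1, 0)),
         ((1, 1, 0, 0), (0, 1, 1, 0), (1, 0, 1, 0)), ((1, 1, 0, 1), (1, 1, 0, 1), (0, 0, 0, 0)),
         ((1, 1, 1, 0), (1, 0, 0, 0), (0, 1, 1, 0)), ((1, 1, 1, 1), (0, 0, 1, 1), (1, 1, 0, 0))]"])
     (simp_all add: Z_simps)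

lemma has_complete_mapping_4_2_2: "has_complete_mapping (Z 4 \<times>\<times> Z 2 \<times>\<times> Z 2)"
  by (rule has_complete_mapping_by_list[where ts =
       "[((0, 0, 0), (0, 1, 0), (0, 1, 0)), ((0, 0, 1), (1, 0, 0), (3, 0, 1)),
         ((0, 1, 0), (2, 1, 1), (2, 0, 1)), ((0, 1, 1), (3, 0, 0), (1, 1, 1)),
         ((1, 0, 0), (0, 0, 0), (3, 0, 0)), ((1, 0, 1), (1, 0, 1), (2, 0, 0)),
         ((1, 1, 0), (2, 0, 0), (1, 1, 0)), ((1, 1, 1), (3, 1, 1), (0, 0, 0)),
         ((2, 0, 0), (2, 0, 1), (0, 0, 1)), ((2, 0, 1), (3, 1, 0), (3, 1, 1)),
         ((2, 1, 0), (1, 1, 1), (1, 0, 1)), ((2, 1, 1), (0, 0, 1), (2, 1, 0)),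
         ((3, 0, 0), (2, 1, 0), (3, 1, 0)), ((3, 0, 1), (1, 1, 0), (0, 1, 1)),
         ((3, 1, 0), (3, 0, 1), (2, 1, 1)), ((3, 1, 1), (0, 1, 1), (1, 0, 0))]"])
     (simp_all add: Z_simps)

lemma has_complete_mapping_4_2_2_2: "has_complete_mapping (Z 4 \<times>\<times> Z 2 \<times>\<times> Z 2 \<times>\<times> Z 2)"
  by (rule has_complete_mapping_by_list[where ts =
       "[((0, 0, 0, 0), (3, 0, 1, 0), (1, 0, 1, 0)), ((0, 0, 0, 1), (3, 1, 0, 0), (1, 1, 0, 1)),
         ((0, 0, 1, 0), (0, 1, 0, 1), (0, 1, 1, 1)), ((0, 0, 1, 1), (3, 0, 1, 1), (1, 0, 0, 0)),
         ((0, 1, 0, 0), (1, 1, 1, 0), (3, 0, 1, 0)), ((0, 1, 0, 1), (3, 0, 0, 1), (1, 1, 0, 0)),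
         ((0, 1, 1, 0), (2, 1, 1, 1), (2, 0, 0, 1)), ((0, 1, 1, 1), (2, 0, 0, 0), (2, 1, 1, 1)),
         ((1, 0, 0, 0), (1, 1, 0, 0), (2, 1, 0, 0)), ((1, 0, 0, 1), (0, 0, 0, 1), (3, 0, 0, 0)),
         ((1, 0, 1, 0), (0, 1, 0, 0), (3, 1, 1, 0)), ((1, 0, 1, 1), (0, 1, 1, 0), (3, 1, 0, 1)),
         ((1, 1, 0, 0), (2, 1, 0, 1), (1, 0, 0, 1)), ((1, 1, 0, 1), (1, 0, 1, 1), (2, 1, 1, 0)),
         ((1, 1, 1, 0), (0, 0, 1, 0), (3, 1, 0, 0)), ((1, 1, 1, 1), (2, 1, 0, 0), (1, 0, 1, 1)),
         ((2, 0, 0, 0), (2, 1, 1, 0), (0, 1, 1, 0)), ((2, 0, 0, 1), (2, 0, 1, 0), (0, 0, 1, 1)),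
         ((2, 0, 1, 0), (0, 0, 0, 0), (2, 0, 1, 0)), ((2, 0, 1, 1), (3, 0, 0, 0), (3, 0, 1, 1)),
         ((2, 1, 0, 0), (2, 0, 0, 1), (0, 1, 0, 1)), ((2, 1, 0, 1), (1, 0, 1, 0), (1, 1, 1, 1)),
         ((2, 1, 1, 0), (0, 0, 1, 1), (2, 1, 0, 1)), ((2, 1, 1, 1), (3, 1, 1, 0), (3, 0, 0, 1)),
         ((3, 0, 0, 0), (1, 0, 0, 1), (0, 0, 0, 1)), ((3, 0, 0, 1), (0, 1, 1, 1), (1, 1, 1, 0)),
         ((3, 0, 1, 0), (1, 0, 0, 0), (0, 0, 1, 0)), ((3, 0, 1, 1), (1, 1, 1, 1), (0, 1, 0, 0)),
         ((3, 1, 0, 0), (2, 0, 1, 1), (3, 1, 1, 1)), ((3, 1, 0, 1), (1, 1, 0, 1), (0, 0, 0, 0)),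
         ((3, 1, 1, 0), (3, 1, 0, 1), (2, 0, 1, 1)), ((3, 1, 1, 1), (3, 1, 1, 1), (2, 0, 0, 0))]"])
     (simp_all add: Z_simps)

section \<open>Four base decompositions\<close>

text \<open>The excluded elements are those of square \<open>\<one>\<close> and the two generators
  of one subgroup of order 3, which leaves \<open>48 - 16 - 2 = 6 * 5\<close>. The trivial factor
  \<open>Z 1\<close> keeps the shape of the groups with a second factor of order 3.\<close>

lemma decomposable_3_1_2_2_2_2:
  "decomposable (Z 3 \<times>\<times> Z 1 \<times>\<times> Z 2 \<times>\<times> Z 2 \<times>\<times> Z 2 \<times>\<times> Z 2)
    (carrier (Z 3 \<times>\<times> Z 1 \<times>\<times> Z 2 \<times>\<times> Z 2 \<times>\<times> Z 2 \<times>\<times> Z 2) -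
      ({0} \<times> {0} \<times> {0, 1} \<times> carrier (Z 2 \<times>\<times> Z 2 \<times>\<times> Z 2) \<union>
       {(1, 0, 0, 0, 0, 0), (2, 0, 0, 0, 0, 0)}))"
  by (rule decomposable_by_list[where
        cs = "List.product [0, 1, 2] (List.product [0] (List.product [0, 1] (List.product [0, 1] (List.product [0, 1] [0, 1]))))" and
        fs = "List.product [0] (List.product [0] (List.product [0, 1] (List.product [0, 1] (List.product [0, 1] [0, 1])))) @
          [(1, 0, 0, 0, 0, 0), (2, 0, 0, 0, 0, 0)]" and
        neg = "\<lambda>(p, s, a, u, v, w). ((- p) mod 3, (- s) mod 1, (- a) mod 2, (- u) mod 2, (- v) mod 2, (- w) mod 2)" and
        ts = "[((1, 0, 1, 0, 1, 1), (1, 0, 1, 0, 1, 0), (1, 0, 0, 0, 0, 1)),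
         ((1, 0, 0, 1, 1, 0), (1, 0, 0, 1, 0, 0), (1, 0, 0, 0, 1, 0)),
         ((1, 0, 1, 1, 1, 0), (1, 0, 1, 1, 0, 1), (1, 0, 0, 0, 1, 1)),
         ((1, 0, 1, 1, 0, 0), (1, 0, 1, 0, 0, 1), (1, 0, 0, 1, 0, 1)),
         ((1, 0, 1, 1, 1, 1), (1, 0, 1, 0, 0, 0), (1, 0, 0, 1, 1, 1))]"],
      simp add: DirProd_group, simp add: Z_simps, simp add: Z_simps, (auto simp: Z_simps)[1],
      (auto simp: Z_simps)[1], simp add: Z_simps, (auto simp: carrier_integer_mod_group DirProd_group)[1], code_simp)

lemma decomposable_3_1_4_2_2_2:
  "decomposable (Z 3 \<times>\<times> Z 1 \<times>\<times> Z 4 \<times>\<times> Z 2 \<times>\<times> Z 2 \<times>\<times> Z 2)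
    (carrier (Z 3 \<times>\<times> Z 1 \<times>\<times> Z 4 \<times>\<times> Z 2 \<times>\<times> Z 2 \<times>\<times> Z 2) -
      ({0} \<times> {0} \<times> {0, 2} \<times> carrier (Z 2 \<times>\<times> Z 2 \<times>\<times> Z 2) \<union>
       {(1, 0, 0, 0, 0, 0), (2, 0, 0, 0, 0, 0)}))"
  by (rule decomposable_by_list[where
        cs = "List.product [0, 1, 2] (List.product [0] (List.product [0, 1, 2, 3] (List.product [0, 1] (List.product [0, 1] [0, 1]))))" and
        fs = "List.product [0] (List.product [0] (List.product [0, 2] (List.product [0, 1] (List.product [0, 1] [0, 1])))) @
          [(1, 0, 0, 0, 0, 0), (2, 0, 0, 0, 0, 0)]" and
        neg = "\<lambda>(p, s, a, u, v, w). ((- p) mod 3, (- s) mod 1, (- a) mod 4, (- u) mod 2, (- v) mod 2, (- w) mod 2)" and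
        ts = "[((1, 0, 2, 0, 0, 0), (2, 0, 1, 1, 0, 1), (0, 0, 1, 1, 0, 1)),
         ((1, 0, 2, 0, 0, 1), (1, 0, 1, 0, 0, 1), (1, 0, 1, 0, 0, 0)),
         ((1, 0, 2, 0, 1, 1), (2, 0, 1, 0, 0, 1), (0, 0, 1, 0, 1, 0)),
         ((2, 0, 1, 1, 1, 0), (0, 0, 3, 0, 0, 0), (1, 0, 0, 1, 1, 0)),
         ((2, 0, 1, 0, 1, 1), (2, 0, 3, 1, 1, 1), (2, 0, 0, 1, 0, 0)),
         ((2, 0, 1, 0, 0, 0), (0, 0, 3, 1, 1, 1), (1, 0, 0, 1, 1, 1)),
         ((1, 0, 1, 1, 1, 0), (0, 0, 3, 0, 1, 1), (2, 0, 0, 1, 0, 1)),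
         ((1, 0, 2, 0, 1, 0), (2, 0, 3, 0, 1, 1), (0, 0, 3, 0, 0, 1)),
         ((1, 0, 2, 1, 1, 0), (1, 0, 1, 1, 0, 0), (1, 0, 1, 0, 1, 0)),
         ((2, 0, 1, 1, 1, 1), (0, 0, 3, 1, 0, 0), (1, 0, 0, 0, 1, 1)),
         ((2, 0, 1, 1, 0, 0), (2, 0, 3, 1, 0, 1), (2, 0, 0, 0, 0, 1)),
         ((1, 0, 2, 1, 1, 1), (1, 0, 2, 1, 0, 1), (1, 0, 0, 0, 1, 0)),
         ((1, 0, 2, 1, 0, 0), (2, 0, 1, 0, 1, 0), (0, 0, 1, 1, 1, 0))]"],
      simp add: DirProd_group, simp add: Z_simps, simp add: Z_simps, (auto simp: Z_simps)[1],
      (auto simp: Z_simps)[1], simp add: Z_simps, (auto simp: carrier_integer_mod_group DirProd_group)[1], code_simp)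

text \<open>Without the elements of square \<open>\<one>\<close> there are
  \<open>72 - 8 = 64\<close> elements, and 64 is 4 modulo 6. Hence two subgroups of order 3 are
  excluded, which leaves \<open>6 * 10\<close>.\<close>

lemma decomposable_3_3_2_2_2:
  "decomposable (Z 3 \<times>\<times> Z 3 \<times>\<times> Z 2 \<times>\<times> Z 2 \<times>\<times> Z 2)
    (carrier (Z 3 \<times>\<times> Z 3 \<times>\<times> Z 2 \<times>\<times> Z 2 \<times>\<times> Z 2) -
      ({0} \<times> {0} \<times> {0, 1} \<times> carrier (Z 2 \<times>\<times> Z 2) \<union>
       {(1, 0, 0, 0, 0), (2, 0, 0, 0, 0), (0, 1, 0, 0, 0), (0, 2, 0, 0, 0)}))"
  by (rule decomposable_by_list[where
        cs = "List.product [0, 1, 2] (List.product [0, 1, 2] (List.product [0, 1] (List.product [0, 1] [0, 1])))" and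
        fs = "List.product [0] (List.product [0] (List.product [0, 1] (List.product [0, 1] [0, 1]))) @
          [(1, 0, 0, 0, 0), (2, 0, 0, 0, 0), (0, 1, 0, 0, 0), (0, 2, 0, 0, 0)]" and
        neg = "\<lambda>(p, s, a, u, v). ((- p) mod 3, (- s) mod 3, (- a) mod 2, (- u) mod 2, (- v) mod 2)" and
        ts = "[((1, 1, 0, 0, 0), (2, 0, 0, 1, 1), (0, 2, 0, 1, 1)),
         ((1, 1, 1, 1, 0), (1, 0, 1, 1, 1), (1, 2, 0, 0, 1)),
         ((1, 1, 1, 0, 1), (0, 1, 1, 1, 1), (2, 1, 0, 1, 0)),
         ((1, 2, 1, 0, 0), (0, 2, 1, 1, 0), (2, 2, 0, 1, 0)),
         ((1, 2, 1, 1, 1), (0, 2, 1, 0, 0), (2, 2, 0, 1, 1)),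
         ((1, 0, 1, 0, 1), (1, 0, 1, 0, 0), (1, 0, 0, 0, 1)),
         ((1, 2, 0, 0, 0), (2, 2, 0, 0, 1), (0, 2, 0, 0, 1)),
         ((1, 0, 1, 1, 0), (0, 2, 1, 0, 1), (2, 1, 0, 1, 1)),
         ((1, 2, 1, 0, 1), (2, 2, 1, 1, 1), (0, 2, 0, 1, 0)),
         ((1, 2, 1, 1, 0), (1, 1, 1, 0, 0), (1, 0, 0, 1, 0))]"],
      simp add: DirProd_group, simp add: Z_simps, simp add: Z_simps, (auto simp: Z_simps)[1],
      (auto simp: Z_simps)[1], simp add: Z_simps, (auto simp: carrier_integer_mod_group DirProd_group)[1], code_simp)

lemma decomposable_3_3_4_2_2:
  "decomposable (Z 3 \<times>\<times> Z 3 \<times>\<times> Z 4 \<times>\<times> Z 2 \<times>\<times> Z 2)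
    (carrier (Z 3 \<times>\<times> Z 3 \<times>\<times> Z 4 \<times>\<times> Z 2 \<times>\<times> Z 2) -
      ({0} \<times> {0} \<times> {0, 2} \<times> carrier (Z 2 \<times>\<times> Z 2) \<union>
       {(1, 0, 0, 0, 0), (2, 0, 0, 0, 0), (0, 1, 0, 0, 0), (0, 2, 0, 0, 0)}))"
  by (rule decomposable_by_list[where
        cs = "List.product [0, 1, 2] (List.product [0, 1, 2] (List.product [0, 1, 2, 3] (List.product [0, 1] [0, 1])))" and
        fs = "List.product [0] (List.product [0] (List.product [0, 2] (List.product [0, 1] [0, 1]))) @
          [(1, 0, 0, 0, 0), (2, 0, 0, 0, 0), (0, 1, 0, 0, 0), (0, 2, 0, 0, 0)]" and
        neg = "\<lambda>(p, s, a, u, v). ((- p) mod 3, (- s) mod 3, (- a) mod 4, (- u) mod 2, (- v) mod 2)" and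
        ts = "[((1, 1, 2, 0, 0), (2, 1, 1, 1, 1), (0, 1, 1, 1, 1)),
         ((1, 2, 1, 1, 1), (0, 0, 3, 1, 1), (2, 1, 0, 0, 0)),
         ((1, 0, 1, 0, 0), (0, 0, 3, 0, 1), (2, 0, 0, 0, 1)),
         ((1, 2, 1, 1, 0), (0, 2, 3, 0, 0), (2, 2, 0, 1, 0)),
         ((1, 1, 2, 0, 1), (2, 2, 3, 0, 1), (0, 0, 3, 0, 0)),
         ((2, 2, 1, 0, 1), (0, 2, 3, 1, 0), (1, 2, 0, 1, 1)),
         ((1, 2, 2, 0, 1), (1, 1, 3, 1, 0), (1, 0, 3, 1, 1)),
         ((1, 0, 2, 0, 1), (2, 1, 1, 0, 1), (0, 2, 1, 0, 0)),
         ((0, 1, 2, 1, 1), (0, 2, 1, 0, 1), (0, 0, 1, 1, 0)),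
         ((1, 2, 2, 0, 0), (1, 0, 2, 1, 1), (1, 1, 0, 1, 1)),
         ((2, 2, 1, 0, 0), (1, 0, 3, 1, 0), (0, 1, 0, 1, 0)),
         ((1, 0, 2, 0, 0), (0, 2, 2, 0, 1), (2, 1, 0, 0, 1)),
         ((2, 1, 1, 0, 0), (2, 2, 3, 1, 0), (2, 0, 0, 1, 0)),
         ((0, 1, 2, 1, 0), (1, 0, 3, 0, 1), (2, 2, 3, 1, 1)),
         ((1, 2, 2, 1, 0), (1, 0, 2, 1, 0), (1, 1, 0, 0, 0)),
         ((2, 2, 1, 1, 1), (2, 0, 3, 0, 1), (2, 1, 0, 1, 0)),
         ((1, 2, 2, 1, 1), (2, 2, 2, 1, 0), (0, 2, 0, 0, 1)),
         ((0, 1, 2, 0, 0), (1, 0, 3, 0, 0), (2, 2, 3, 0, 0)),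
         ((1, 2, 1, 0, 0), (2, 0, 3, 1, 1), (0, 1, 0, 1, 1)),
         ((2, 1, 1, 1, 0), (0, 2, 3, 0, 1), (1, 0, 0, 1, 1)),
         ((1, 0, 1, 1, 0), (0, 1, 3, 1, 1), (2, 2, 0, 0, 1)),
         ((1, 1, 2, 1, 1), (2, 1, 3, 0, 1), (0, 1, 3, 1, 0))]"],
      simp add: DirProd_group, simp add: Z_simps, simp add: Z_simps, (auto simp: Z_simps)[1],
      (auto simp: Z_simps)[1], simp add: Z_simps, (auto simp: carrier_integer_mod_group DirProd_group)[1], code_simp)

section \<open>The case of exceptional subgroups of order 3\<close>

text \<open>In the applications \<open>\<tau>\<close> is odd, \<open>N\<close> even and
  \<open>V\<close> of exponent 2, so the first part is the set of elements of square
  \<open>\<one>\<close>, and \<open>T\<close> holds the generators of the exceptional subgroups of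
  order 3.\<close>

definition special :: "'v monoid \<Rightarrow> (int \<times> int) set \<Rightarrow> nat \<Rightarrow> (int \<times> int \<times> int \<times> 'v) set" where
  "special V T N = {0} \<times> {0} \<times> {0, int N div 2} \<times> carrier V \<union> (\<lambda>(p, s). (p, s, 0, \<one>\<^bsub>V\<^esub>)) ` T"

definition special_times :: "'v monoid \<Rightarrow> (int \<times> int) set \<Rightarrow> nat \<Rightarrow> (int \<times> int \<times> int \<times> int \<times> 'v) set" where
  "special_times V T N = (\<lambda>(p, s, a, v). (p, 0, s, a, v)) ` special V T N"

lemma special_times_iff:
  "(p, q, s, a, v) \<in> special_times V T N \<longleftrightarrow> q = 0 \<and> (p, s, a, v) \<in> special V T N"
  unfolding special_times_def by force

lemma special_iff:
  "(p, s, a, v) \<in> special V T N \<longleftrightarrow>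
     p = 0 \<and> s = 0 \<and> (a = 0 \<or> a = int N div 2) \<and> v \<in> carrier V \<or> (p, s) \<in> T \<and> a = 0 \<and> v = \<one>\<^bsub>V\<^esub>"
  unfolding special_def by force

text \<open>The elements with coordinate 0 in \<open>Z k\<close> form a copy of the base group. All
  others are covered by the triples of \<open>decomposable_3_odd\<close>, lifted by the complete
  mapping of the remaining factors.\<close>

lemma decomposable_times_odd:
  fixes V :: "'v monoid"
  assumes V: "comm_group V" and k: "odd k"
    and cm: "has_complete_mapping (Z \<tau> \<times>\<times> Z N \<times>\<times> V)"
    and base: "decomposable (Z 3 \<times>\<times> Z \<tau> \<times>\<times> Z N \<times>\<times> V)
      (carrier (Z 3 \<times>\<times> Z \<tau> \<times>\<times> Z N \<times>\<times> V) - special V T N)"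
  shows "decomposable (Z 3 \<times>\<times> Z k \<times>\<times> Z \<tau> \<times>\<times> Z N \<times>\<times> V)
      (carrier (Z 3 \<times>\<times> Z k \<times>\<times> Z \<tau> \<times>\<times> Z N \<times>\<times> V) - special_times V T N)"
proof -
  let ?W = "Z \<tau> \<times>\<times> Z N \<times>\<times> V" and ?H = "Z 3 \<times>\<times> Z \<tau> \<times>\<times> Z N \<times>\<times> V"
    and ?G = "Z 3 \<times>\<times> Z k \<times>\<times> Z \<tau> \<times>\<times> Z N \<times>\<times> V"
  have grp: "group ?W" "group ?G" "group ?H" "group (Z 3 \<times>\<times> Z k)" "group ((Z 3 \<times>\<times> Z k) \<times>\<times> ?W)"
    using V by (auto intro!: DirProd_group simp: comm_group.axioms)
  let ?h = "\<lambda>(p :: int, w). (p, 0 :: int, w)" and ?g = "\<lambda>((p :: int, q :: int), w). (p, q, w)"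
  have "?h \<in> hom ?H ?G" by (auto simp: hom_def)
  moreover have "inj_on ?h (carrier ?H)" by (auto simp: inj_on_def)
  ultimately have 1: "decomposable ?G (?h ` (carrier ?H - special V T N))"
    using base grp by (intro decomposable_image[of ?H])
  have "?g \<in> hom ((Z 3 \<times>\<times> Z k) \<times>\<times> ?W) ?G" by (auto simp: hom_def)
  moreover have "inj_on ?g (carrier ((Z 3 \<times>\<times> Z k) \<times>\<times> ?W))" by (auto simp: inj_on_def)
  ultimately have 2: "decomposable ?G (?g ` (({0, 1, 2} \<times> {1..<int k}) \<times> carrier ?W))"
    using grp by (intro decomposable_image[OF grp(5,2)] decomposable_DirProd decomposable_3_odd k cm)
  have "carrier ?G - special_times V T N =
      ?h ` (carrier ?H - special V T N) \<union> ?g ` (({0, 1, 2} \<times> {1..<int k}) \<times> carrier ?W)"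
  proof (rule Set.set_eqI)
    fix x :: "int \<times> int \<times> int \<times> int \<times> 'v"
    obtain p q s a v where x: "x = (p, q, s, a, v)" by (cases x)
    have h: "x \<in> ?h ` S \<longleftrightarrow> q = 0 \<and> (p, s, a, v) \<in> S" for S unfolding x by force
    have g: "x \<in> ?g ` S \<longleftrightarrow> ((p, q), (s, a, v)) \<in> S" for S unfolding x by force
    have "k > 0" using k by (rule odd_pos)
    then show "x \<in> carrier ?G - special_times V T N \<longleftrightarrow>
        x \<in> ?h ` (carrier ?H - special V T N) \<union> ?g ` (({0, 1, 2} \<times> {1..<int k}) \<times> carrier ?W)"
      unfolding Un_iff h g unfolding x Diff_iff special_times_iff
      by (auto simp: carrier_Z int_atLeastLessThan_simps)
  qed
  moreover have "?h ` (carrier ?H - special V T N) \<inter> ?g ` (({0, 1, 2} \<times> {1..<int k}) \<times> carrier ?W) = {}"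
    by auto
  ultimately show ?thesis using decomposable_Un[OF 1 2] by simp
qed

text \<open>Multiplication by 4 embeds \<open>Z (2 * M)\<close> in \<open>Z (8 * M)\<close>. Its
  image carries the given decomposition, and the residues not divisible by 4 are covered by
  \<open>decomposable_not_div_4\<close>, lifted by the complete mapping of \<open>V\<close>.\<close>

lemma decomposable_times_4:
  fixes V :: "'v monoid"
  assumes V: "comm_group V" and odd: "odd k" "odd \<tau>" and M: "M > 0"
    and cm: "has_complete_mapping V"
    and base: "decomposable (Z 3 \<times>\<times> Z k \<times>\<times> Z \<tau> \<times>\<times> Z (2 * M) \<times>\<times> V)
      (carrier (Z 3 \<times>\<times> Z k \<times>\<times> Z \<tau> \<times>\<times> Z (2 * M) \<times>\<times> V) - special_times V T (2 * M))"
  shows "decomposable (Z 3 \<times>\<times> Z k \<times>\<times> Z \<tau> \<times>\<times> Z (8 * M) \<times>\<times> V)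
      (carrier (Z 3 \<times>\<times> Z k \<times>\<times> Z \<tau> \<times>\<times> Z (8 * M) \<times>\<times> V) - special_times V T (8 * M))"
proof -
  let ?D = "Z 3 \<times>\<times> Z k \<times>\<times> Z \<tau>" and ?H = "Z 3 \<times>\<times> Z k \<times>\<times> Z \<tau> \<times>\<times> Z (2 * M) \<times>\<times> V"
    and ?G = "Z 3 \<times>\<times> Z k \<times>\<times> Z \<tau> \<times>\<times> Z (8 * M) \<times>\<times> V"
  have pos: "k > 0" "\<tau> > 0" using odd by (auto intro: odd_pos)
  have grp: "group ?G" "group ?H" "group V" "group (?D \<times>\<times> Z (8 * M))" "group ((?D \<times>\<times> Z (8 * M)) \<times>\<times> V)"
    using V by (auto intro!: DirProd_group simp: comm_group.axioms)
  let ?A = "{a \<in> {0..<int (8 * M)}. a mod 4 \<noteq> 0}"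
  let ?h = "\<lambda>(p :: int, q :: int, s :: int, a :: int, v :: 'v). (p, q, s, 4 * a, v)"
  let ?g = "\<lambda>(((p :: int, q :: int, s :: int), a :: int), v :: 'v). (p, q, s, a, v)"
  have m4: "4 * (a mod (2 * int M)) = (4 * a) mod (8 * int M)" for a
    using mult_mod_right[of 4 a "2 * int M"] by simp
  have "?h \<in> hom ?H ?G" using M by (auto simp: hom_def carrier_Z m4 distrib_left)
  moreover have "inj_on ?h (carrier ?H)" by (auto simp: inj_on_def)
  ultimately have 1: "decomposable ?G (?h ` (carrier ?H - special_times V T (2 * M)))"
    using base grp by (intro decomposable_image[of ?H])
  have half: "\<exists>s\<in>carrier ?D. t = s \<otimes>\<^bsub>?D\<^esub> s" if t: "t \<in> carrier ?D" for t
  proof -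
    obtain a b c where abc: "t = (a, b, c)" "a \<in> carrier (Z 3)" "b \<in> carrier (Z k)" "c \<in> carrier (Z \<tau>)"
      using t by auto
    obtain a' b' c' where "a' \<in> carrier (Z 3)" "a = a' \<otimes>\<^bsub>Z 3\<^esub> a'" "b' \<in> carrier (Z k)" "b = b' \<otimes>\<^bsub>Z k\<^esub> b'"
      "c' \<in> carrier (Z \<tau>)" "c = c' \<otimes>\<^bsub>Z \<tau>\<^esub> c'"
      using ex_half_Z[OF _ abc(2)] ex_half_Z[OF odd(1) abc(3)] ex_half_Z[OF odd(2) abc(4)] by auto
    then show ?thesis unfolding abc(1) by (intro bexI[of _ "(a', b', c')"]) auto
  qed
  have "decomposable (?D \<times>\<times> Z (8 * M)) (carrier ?D \<times> ?A)"
    by (rule decomposable_not_div_4)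
      (use half M pos in \<open>auto intro!: comm_group_DirProd simp: carrier_Z\<close>)
  then have "decomposable ((?D \<times>\<times> Z (8 * M)) \<times>\<times> V) ((carrier ?D \<times> ?A) \<times> carrier V)"
    by (rule decomposable_DirProd[OF grp(4,3) _ cm])
  moreover have "?g \<in> hom ((?D \<times>\<times> Z (8 * M)) \<times>\<times> V) ?G" by (auto simp: hom_def)
  moreover have "inj_on ?g (carrier ((?D \<times>\<times> Z (8 * M)) \<times>\<times> V))" by (auto simp: inj_on_def)
  ultimately have 2: "decomposable ?G (?g ` ((carrier ?D \<times> ?A) \<times> carrier V))"
    by (intro decomposable_image[OF grp(5,1)])
  have "carrier ?G - special_times V T (8 * M) =
      ?h ` (carrier ?H - special_times V T (2 * M)) \<union> ?g ` ((carrier ?D \<times> ?A) \<times> carrier V)"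
  proof (rule Set.set_eqI)
    fix x :: "int \<times> int \<times> int \<times> int \<times> 'v"
    obtain p q s a v where x: "x = (p, q, s, a, v)" by (cases x)
    have h: "x \<in> ?h ` S \<longleftrightarrow> a mod 4 = 0 \<and> (p, q, s, a div 4, v) \<in> S" for S unfolding x by force
    have g: "x \<in> ?g ` S \<longleftrightarrow> (((p, q, s), a), v) \<in> S" for S unfolding x by force
    \<comment> \<open>The embedding respects the excluded set: it maps \<open>M\<close>, the half of
      \<open>2 * M\<close>, to \<open>4 * M\<close>, the half of \<open>8 * M\<close>, and fixes
      0.\<close>
    have sp: "(p, s, a, v) \<in> special V T (8 * M) \<longleftrightarrow> a mod 4 = 0 \<and> (p, s, a div 4, v) \<in> special V T (2 * M)"
      unfolding special_iff by auto
    have car: "a \<in> {0..<int (8 * M)} \<longleftrightarrow> a div 4 \<in> {0..<int (2 * M)}" by auto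
    show "x \<in> carrier ?G - special_times V T (8 * M) \<longleftrightarrow>
        x \<in> ?h ` (carrier ?H - special_times V T (2 * M)) \<union> ?g ` ((carrier ?D \<times> ?A) \<times> carrier V)"
      unfolding Un_iff h g unfolding x Diff_iff special_times_iff sp
      using M car by (auto simp: carrier_Z)
  qed
  moreover have "?h ` (carrier ?H - special_times V T (2 * M)) \<inter> ?g ` ((carrier ?D \<times> ?A) \<times> carrier V) = {}"
    by auto
  ultimately show ?thesis using decomposable_Un[OF 1 2] by simp
qed

text \<open>Each step raises the exponent of 2 by two, so both parities need a start:
  \<open>N = 2\<close> and \<open>N = 4\<close>.\<close>

lemma decomposable_times_2_power:
  fixes V :: "'v monoid"
  assumes V: "comm_group V" and odd: "odd k" "odd \<tau>"
    and cm: "has_complete_mapping V"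
      "\<And>N. N \<in> {2, 4} \<Longrightarrow> has_complete_mapping (Z \<tau> \<times>\<times> Z N \<times>\<times> V)"
    and base: "\<And>N. N \<in> {2, 4} \<Longrightarrow> decomposable (Z 3 \<times>\<times> Z \<tau> \<times>\<times> Z N \<times>\<times> V)
      (carrier (Z 3 \<times>\<times> Z \<tau> \<times>\<times> Z N \<times>\<times> V) - special V T N)"
  shows "decomposable (Z 3 \<times>\<times> Z k \<times>\<times> Z \<tau> \<times>\<times> Z (2 ^ Suc l) \<times>\<times> V)
      (carrier (Z 3 \<times>\<times> Z k \<times>\<times> Z \<tau> \<times>\<times> Z (2 ^ Suc l) \<times>\<times> V) - special_times V T (2 ^ Suc l))"
proof (induction l rule: less_induct)
  case (less l)
  show ?case
  proof (cases "l < 2")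
    case True
    then have "2 ^ Suc l \<in> {2, 4 :: nat}" by (auto simp: less_Suc_eq numeral_2_eq_2)
    then show ?thesis using cm(2) base by (intro decomposable_times_odd V odd(1))
  next
    case False
    then obtain j where j: "l = j + 2" by (metis add.commute le_Suc_ex not_less)
    have "decomposable (Z 3 \<times>\<times> Z k \<times>\<times> Z \<tau> \<times>\<times> Z (8 * 2 ^ j) \<times>\<times> V)
        (carrier (Z 3 \<times>\<times> Z k \<times>\<times> Z \<tau> \<times>\<times> Z (8 * 2 ^ j) \<times>\<times> V) - special_times V T (8 * 2 ^ j))"
      using less.IH[of j] by (intro decomposable_times_4 V odd cm(1)) (simp_all add: j)
    then show ?thesis by (simp add: j power_add)
  qed
qed

lemma odd_dvd_double_iff:
  fixes a :: int
  assumes "odd n" "0 \<le> a" "a < n"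
  shows "n dvd 2 * a \<longleftrightarrow> a = 0"
proof
  assume "n dvd 2 * a"
  then have "n dvd a" using assms(1) by (simp add: coprime_dvd_mult_right_iff)
  then show "a = 0" using assms zdvd_not_zless[of a n] by force
qed simp

lemma dvd_lt_double_iff:
  fixes a h :: int
  assumes "0 \<le> a" "a < 2 * h"
  shows "h dvd a \<longleftrightarrow> a = 0 \<or> a = h"
proof
  assume "h dvd a"
  then obtain c where c: "a = h * c" by blast
  have h: "h > 0" using assms by simp
  then have "0 \<le> c" using assms(1) c by (simp add: zero_le_mult_iff)
  moreover have "c < 2" using assms(2) c mult_less_cancel_left_pos[OF h, of c 2] by simp
  ultimately have "c = 0 \<or> c = 1" by linarith
  then show "a = 0 \<or> a = h" unfolding c by auto
qed auto

text \<open>The first three factors have odd order, so an element of square \<open>\<one>\<close> is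
  zero there, equals 0 or \<open>N div 2\<close> in the cyclic 2-group, and is arbitrary in
  \<open>V\<close>.\<close>

lemma pyramidal_times_2_power_odd:
  fixes V :: "'v monoid"
  assumes V: "comm_group V" "finite (carrier V)" "card (carrier V) = 2 ^ n" "\<And>v. v \<in> carrier V \<Longrightarrow> v \<otimes>\<^bsub>V\<^esub> v = \<one>\<^bsub>V\<^esub>"
    and odd: "odd k" "odd \<tau>"
    and cm: "has_complete_mapping V"
      "\<And>N. N \<in> {2, 4} \<Longrightarrow> has_complete_mapping (Z \<tau> \<times>\<times> Z N \<times>\<times> V)"
    and E: "E \<subseteq> carrier (Z 3 \<times>\<times> Z \<tau>)" "E \<inter> m_inv (Z 3 \<times>\<times> Z \<tau>) ` E = {}"
      "\<And>p s. (p, s) \<in> E \<Longrightarrow> (p, s) \<noteq> (0, 0) \<and> (p + p + p) mod 3 = 0 \<and> (s + s + s) mod int \<tau> = 0"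
    and base: "\<And>N. N \<in> {2, 4} \<Longrightarrow> decomposable (Z 3 \<times>\<times> Z \<tau> \<times>\<times> Z N \<times>\<times> V)
      (carrier (Z 3 \<times>\<times> Z \<tau> \<times>\<times> Z N \<times>\<times> V) - special V (E \<union> m_inv (Z 3 \<times>\<times> Z \<tau>) ` E) N)"
  shows "pyramidal (Z 3 \<times>\<times> Z k \<times>\<times> Z \<tau> \<times>\<times> Z (2 ^ Suc l) \<times>\<times> V) (3 * \<tau> * k * 2 ^ (l + Suc n)) (Suc n) (card E)"
proof -
  let ?N = "2 ^ Suc l :: nat"
  let ?T = "E \<union> m_inv (Z 3 \<times>\<times> Z \<tau>) ` E"
  let ?G = "Z 3 \<times>\<times> Z k \<times>\<times> Z \<tau> \<times>\<times> Z ?N \<times>\<times> V"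
  have pos: "k > 0" "\<tau> > 0" using odd by (auto intro: odd_pos)
  interpret V: comm_group V by fact
  interpret G: comm_group ?G using V(1) by (auto intro!: comm_group_DirProd)
  define \<iota> where "\<iota> = (\<lambda>(p :: int, s :: int). (p, 0 :: int, s, 0 :: int, \<one>\<^bsub>V\<^esub>))"
  have inj: "inj \<iota>" unfolding \<iota>_def inj_on_def by auto
  have grp: "group (Z \<tau> \<times>\<times> Z ?N \<times>\<times> V)" "group (Z k \<times>\<times> Z \<tau> \<times>\<times> Z ?N \<times>\<times> V)" "group (Z ?N \<times>\<times> V)"
    by (auto intro!: DirProd_group V.is_group)
  have inv_\<iota>: "inv\<^bsub>?G\<^esub> \<iota> t = \<iota> (inv\<^bsub>Z 3 \<times>\<times> Z \<tau>\<^esub> t)" if "t \<in> carrier (Z 3 \<times>\<times> Z \<tau>)" for t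
    using that grp V.is_group unfolding \<iota>_def by auto
  have invE: "m_inv ?G ` \<iota> ` E = \<iota> ` m_inv (Z 3 \<times>\<times> Z \<tau>) ` E"
    unfolding image_image using E(1) inv_\<iota> by (intro image_cong) auto
  have I: "{x \<in> carrier ?G. x \<otimes>\<^bsub>?G\<^esub> x = \<one>\<^bsub>?G\<^esub>} = {0} \<times> {0} \<times> {0} \<times> {0, int ?N div 2} \<times> carrier V"
  proof (rule Set.set_eqI)
    fix x :: "int \<times> int \<times> int \<times> int \<times> 'v"
    obtain p q s a v where x: "x = (p, q, s, a, v)" by (cases x)
    show "x \<in> {x \<in> carrier ?G. x \<otimes>\<^bsub>?G\<^esub> x = \<one>\<^bsub>?G\<^esub>} \<longleftrightarrow> x \<in> {0} \<times> {0} \<times> {0} \<times> {0, int ?N div 2} \<times> carrier V"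
      unfolding x using V(4)[of v] pos odd
      by (auto simp: carrier_Z odd_dvd_double_iff dvd_lt_double_iff[of a "2 ^ l"])
  qed
  have rest: "carrier ?G - {x. x \<otimes>\<^bsub>?G\<^esub> x = \<one>\<^bsub>?G\<^esub>} - (\<iota> ` E \<union> m_inv ?G ` \<iota> ` E) =
      carrier ?G - special_times V ?T ?N"
  proof -
    have "special_times V ?T ?N = {0} \<times> {0} \<times> {0} \<times> {0, int ?N div 2} \<times> carrier V \<union> \<iota> ` ?T"
    proof (rule Set.set_eqI)
      fix x :: "int \<times> int \<times> int \<times> int \<times> 'v"
      obtain p q s a v where x: "x = (p, q, s, a, v)" by (cases x)
      have "x \<in> \<iota> ` S \<longleftrightarrow> q = 0 \<and> a = 0 \<and> v = \<one>\<^bsub>V\<^esub> \<and> (p, s) \<in> S" for S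
        unfolding x \<iota>_def by force
      then show "x \<in> special_times V ?T ?N \<longleftrightarrow>
          x \<in> {0} \<times> {0} \<times> {0} \<times> {0, int ?N div 2} \<times> carrier V \<union> \<iota> ` ?T"
        unfolding Un_iff[of x] unfolding x special_times_iff special_iff by auto
    qed
    then have sp: "special_times V ?T ?N = {x \<in> carrier ?G. x \<otimes>\<^bsub>?G\<^esub> x = \<one>\<^bsub>?G\<^esub>} \<union> (\<iota> ` E \<union> m_inv ?G ` \<iota> ` E)"
      unfolding I invE image_Un .
    show ?thesis unfolding sp by (simp only: Diff_eq, blast)
  qed
  have dec: "decomposable ?G (carrier ?G - {x. x \<otimes>\<^bsub>?G\<^esub> x = \<one>\<^bsub>?G\<^esub>} - (\<iota> ` E \<union> m_inv ?G ` \<iota> ` E))"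
    unfolding rest by (rule decomposable_times_2_power[OF V(1) odd cm base])
  have "card (\<iota> ` E) = card E" using inj by (meson card_image inj_on_subset subset_UNIV)
  moreover have "\<forall>t\<in>\<iota> ` E. t \<noteq> \<one>\<^bsub>?G\<^esub> \<and> t \<otimes>\<^bsub>?G\<^esub> t \<otimes>\<^bsub>?G\<^esub> t = \<one>\<^bsub>?G\<^esub>"
    using E(3) unfolding \<iota>_def by (fastforce simp: mod_simps)
  moreover have "\<iota> ` E \<inter> m_inv ?G ` \<iota> ` E = {}"
    unfolding invE using E(2) inj by (metis image_Int image_empty)
  moreover have "\<iota> ` E \<subseteq> carrier ?G" using E(1) unfolding \<iota>_def by auto
  moreover have "card {x \<in> carrier ?G. x \<otimes>\<^bsub>?G\<^esub> x = \<one>\<^bsub>?G\<^esub>} = 2 ^ Suc n"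
    unfolding I by (simp add: card_cartesian_product V(3))
  moreover have "order ?G = 3 * \<tau> * k * 2 ^ (l + Suc n)"
  proof -
    have "card (carrier (Z n)) = n" if "n > 0" for n using that by (simp add: carrier_Z)
    from this[of 3] this[of k] this[of \<tau>] this[of ?N] show ?thesis
      using pos V(3) by (simp add: order_def card_cartesian_product power_add del: power_Suc) (simp add: power_add)
  qed
  moreover have "finite (carrier ?G)" using pos V(2) by (simp add: carrier_Z)
  ultimately show ?thesis
    unfolding pyramidal_def using dec G.comm_group_axioms by blast
qed

section \<open>The zigzag construction\<close>

text \<open>
  The first components of \<open>L i False\<close> and of \<open>L i True\<close> both form the half of \<open>V\<close> with index \<open>i\<close>, whereas
  the halves formed by the second and the third components depend only on \<open>j\<close>.
\<close>

definition split_mapping :: "'v monoid \<Rightarrow> (bool \<Rightarrow> bool \<Rightarrow> ('v \<times> 'v \<times> 'v) list) \<Rightarrow> bool" where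
  "split_mapping V L \<longleftrightarrow>
     (\<forall>i j. set (L i j) \<subseteq> zero_sum_triples V \<and> 2 * length (L i j) \<le> order V) \<and>
     (\<forall>v\<in>carrier V. (\<exists>i. \<forall>j. \<exists>y z. (v, y, z) \<in> set (L i j)) \<and>
        (\<exists>j. \<forall>i. \<exists>x z. (x, v, z) \<in> set (L i j)) \<and> (\<exists>j. \<forall>i. \<exists>x y. (x, y, v) \<in> set (L i j)))"

text \<open>
  For the value \<open>(b, j, s)\<close>, the layers \<open>r, b, b + r\<close> form a triple in which \<open>r\<close> uses the half \<open>i\<close>, and \<open>b\<close>
  and \<open>b + r\<close> use the half \<open>j\<close> of \<open>V\<close>; the flag \<open>s\<close> tells which of \<open>b\<close>, \<open>b + r\<close> has the first colour. The
  last case is the edge closing the two paths to a cycle.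
\<close>

definition zigzag :: "int \<Rightarrow> int \<Rightarrow> bool \<Rightarrow> int \<times> bool \<times> bool" where
  "zigzag k r i =
     (if \<not> i then (k + (k + 2 - r) div 2, odd (r + k), False)
      else if r < k then (2 * k + (k + 2 - r) div 2, odd (r + k), True)
      else (k + k div 2 + 1, odd k, even k))"

lemma zigzag_bounds:
  assumes "zigzag k r i = (b, j, s)" "1 \<le> r" "r \<le> k"
  shows "k < b" "b + r \<le> 3 * k"
  using assms unfolding zigzag_def by (auto split: if_splits)

text \<open>\<open>g\<close> is the first colour of the cycle: the lower half of
  \<open>(k, 2k]\<close> and the upper half of \<open>(2k, 3k]\<close>. The value \<open>j\<close>
  alternates along the edges, so each vertex \<open>a\<close> has one edge of either value.\<close>

lemma ex_zigzag:
  fixes a k :: int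
  assumes a: "k < a" "a \<le> 3 * k"
  defines "g \<equiv> (if a \<le> 2 * k then a - k \<le> (k + 1) div 2 else a - 2 * k > (k + 1) div 2)"
  shows "\<exists>r i b s. 1 \<le> r \<and> r \<le> k \<and> zigzag k r i = (b, j, s) \<and> (b = a \<and> (s \<longleftrightarrow> \<not> g) \<or> b + r = a \<and> (s \<longleftrightarrow> g))"
proof -
  have wit: ?thesis if "1 \<le> r" "r \<le> k" "zigzag k r i = (b, j, s)"
    "b = a \<and> (s \<longleftrightarrow> \<not> g) \<or> b + r = a \<and> (s \<longleftrightarrow> g)" for r i b s
    using that by blast
  \<comment> \<open>\<open>h\<close> selects the interval and \<open>x\<close> is the position in
    it. In the lower half \<open>a\<close> is the smaller end \<open>b\<close> of its edge, in the
    upper half the larger end \<open>b + r\<close>, except where the two paths are joined.\<close>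
  define h where "h = (\<not> a \<le> 2 * k)"
  define x where "x = (if h then a - 2 * k else a - k)"
  have ax: "a = (if h then 2 * k else k) + x" unfolding x_def by simp
  have x: "1 \<le> x" "x \<le> k" unfolding x_def h_def using a by auto
  have g: "g \<longleftrightarrow> (x \<le> (k + 1) div 2) \<noteq> h" unfolding g_def x_def h_def by auto
  show ?thesis
  proof (cases "x \<le> (k + 1) div 2")
    case low: True
    show ?thesis
    proof (cases j)
      case True
      show ?thesis
      proof (cases "2 * x \<le> k")
        case 1: True
        show ?thesis
          by (rule wit[of "k + 1 - 2 * x" h a h]) (use x 1 True g low ax in \<open>auto simp: zigzag_def\<close>)
      next
        case False
        \<comment> \<open>For odd \<open>k\<close> this is the last vertex of its path; the edge
          sought is the one closing the cycle.\<close>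
        then have "k = 2 * x - 1" using low by presburger
        then show ?thesis
          by (intro wit[of k True "k + x" False]) (use x True g low ax in \<open>auto simp: zigzag_def\<close>)
      qed
    next
      case False
      show ?thesis
      proof (cases "h \<and> x = 1")
        case 1: True
        \<comment> \<open>The vertex \<open>2 * k + 1\<close> starts the second path and is joined
          to \<open>k + 1\<close> by the edge with \<open>r = k\<close>.\<close>
        show ?thesis by (rule wit[of k False "k + 1" False]) (use x 1 False g low ax in \<open>auto simp: zigzag_def\<close>)
      next
        case 2: False
        have "2 * x \<le> k + 1" using low by presburger
        then show ?thesis
          by (intro wit[of "k + 2 - 2 * x" h a h]) (use x 2 False g low ax in \<open>auto simp: zigzag_def\<close>)
      qed
    qed
  next
    case high: False
    then have "k + 2 \<le> 2 * x" by presburger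
    show ?thesis
    proof (cases j)
      case True
      have "(k + 2 - (2 * x - k - 1)) div 2 = k + 1 - x" by presburger
      then show ?thesis
        by (intro wit[of "2 * x - k - 1" h "(if h then 2 * k else k) + (k + 1 - x)" h]) (use x True g high ax \<open>k + 2 \<le> 2 * x\<close> in \<open>auto simp: zigzag_def\<close>)
    next
      case False
      show ?thesis
      proof (cases "2 * x = k + 2")
        case 1: True
        \<comment> \<open>For even \<open>k\<close> this is the last vertex of its path, met again
          by the closing edge.\<close>
        then have "k = 2 * x - 2" by simp
        then show ?thesis
          by (intro wit[of k True "k + x" True]) (use x False g high ax in \<open>auto simp: zigzag_def\<close>)
      next
        case 2: False
        have "(k + 2 - (2 * x - k - 2)) div 2 = k + 2 - x" by presburger
        then show ?thesis
          by (intro wit[of "2 * x - k - 2" h "(if h then 2 * k else k) + (k + 2 - x)" h]) (use x 2 False g high ax \<open>k + 2 \<le> 2 * x\<close> in \<open>auto simp: zigzag_def\<close>)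
      qed
    qed
  qed
qed

text \<open>Elements of \<open>V\<close> are their own inverses, so negation only changes the layer
  and the layers 1 to \<open>3 * k\<close> suffice. Each is met by two of the \<open>2 * k\<close>
  layer triples, once for each half of \<open>V\<close>. A layer triple has
  \<open>order V div 2\<close> lifts, which gives \<open>6 * k * order V\<close> signed
  components.\<close>

lemma decomposable_zigzag:
  fixes V :: "'v monoid"
  assumes V: "comm_group V" "finite (carrier V)" "\<And>v. v \<in> carrier V \<Longrightarrow> v \<otimes>\<^bsub>V\<^esub> v = \<one>\<^bsub>V\<^esub>"
    and L: "split_mapping V L"
  shows "decomposable (Z (6 * k + 2) \<times>\<times> V) (({1..<6 * int k + 2} - {3 * int k + 1}) \<times> carrier V)"
    (is "decomposable ?G ?X")
proof -
  define n where "n = 6 * k + 2"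
  let ?G = "Z n \<times>\<times> V"
  interpret V: comm_group V by fact
  interpret G: comm_group ?G using V by (simp add: comm_group_DirProd)
  define K where "K = int k"
  define N where "N = 6 * K + 2"
  have nN: "int n = N" and n0: "n > 0" unfolding n_def N_def K_def by simp_all
  have car: "carrier (Z n) = {0..<N}" using n0 nN by (simp add: carrier_Z)
  have invV: "inv\<^bsub>V\<^esub> v = v" if "v \<in> carrier V" for v
    using V(3)[OF that] that by (intro V.inv_equality)
  have inv_G: "inv\<^bsub>?G\<^esub> (a, v) = (N - a, v)" if "0 < a" "a < N" "v \<in> carrier V" for a v
    using that inv_Z[of a n] invV[of v] nN n0 by (simp add: car)
  \<comment> \<open>The third layer is negated so that the layers sum to \<open>N\<close>. The flag
    \<open>s\<close> swaps the last two components, so that a vertex of the first colour always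
    receives the second component.\<close>
  define f where "f = (\<lambda>r i (u :: 'v, v :: 'v, w :: 'v). let (b, j, s) = zigzag K r i in
      ((r, u), (b, if s then w else v), (N - (b + r), if s then v else w)))"
  define B where "B = (\<Union>(r, i)\<in>{1..K} \<times> UNIV. f r i ` set (L i (fst (snd (zigzag K r i)))))"
  have mem: "((r, u), (b, if s then w else v), (N - (b + r), if s then v else w)) \<in> B"
    if "1 \<le> r" "r \<le> K" "zigzag K r i = (b, j, s)" "(u, v, w) \<in> set (L i j)" for r i b j s u v w
  proof -
    have "f r i (u, v, w) \<in> B" unfolding B_def using that by force
    then show ?thesis unfolding f_def using that(3) by simp
  qed
  have Lz: "set (L i j) \<subseteq> zero_sum_triples V" "2 * length (L i j) \<le> order V" for i j
    using L unfolding split_mapping_def by blast+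
  have B: "B \<subseteq> zero_sum_triples ?G"
  proof
    fix t assume "t \<in> B"
    then obtain r i u v w where t: "1 \<le> r" "r \<le> K" "(u, v, w) \<in> set (L i (fst (snd (zigzag K r i))))" "t = f r i (u, v, w)"
      unfolding B_def by auto
    obtain b j s where z: "zigzag K r i = (b, j, s)" by (cases "zigzag K r i")
    have uvw: "u \<in> carrier V" "v \<in> carrier V" "w \<in> carrier V" "u \<otimes>\<^bsub>V\<^esub> v \<otimes>\<^bsub>V\<^esub> w = \<one>\<^bsub>V\<^esub>"
      using t(3) Lz(1) unfolding zero_sum_triples_def by blast+
    then have "u \<otimes>\<^bsub>V\<^esub> w \<otimes>\<^bsub>V\<^esub> v = \<one>\<^bsub>V\<^esub>" by (simp add: V.m_assoc V.m_comm[of w v])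
    then show "t \<in> zero_sum_triples ?G"
      using uvw t(1,2) zigzag_bounds[OF z t(1,2)] z unfolding t(4) f_def zero_sum_triples_def
      by (auto simp: car nN mod_simps N_def)
  qed
  have pos: "(a, v) \<in> signed_parts ?G B" if a: "1 \<le> a" "a \<le> 3 * K" and v: "v \<in> carrier V" for a v
  proof (cases "a \<le> K")
    case True
    \<comment> \<open>The half \<open>i\<close> containing \<open>v\<close> is fixed first; it works
      for whatever \<open>j\<close> the zigzag assigns to this layer.\<close>
    obtain i where "\<forall>j. \<exists>y z. (v, y, z) \<in> set (L i j)" using L v unfolding split_mapping_def by blast
    moreover obtain b j s where z: "zigzag K a i = (b, j, s)" by (cases "zigzag K a i")
    ultimately obtain y z where "(v, y, z) \<in> set (L i j)" by blast
    from signed_partsI[OF mem[OF a(1) True z this]] show ?thesis by blast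
  next
    case False
    define g where "g \<longleftrightarrow> (if a \<le> 2 * K then a - K \<le> (K + 1) div 2 else a - 2 * K > (K + 1) div 2)"
    \<comment> \<open>The colour of \<open>a\<close> decides which component must equal
      \<open>v\<close>, and this fixes \<open>j\<close>. The edge at \<open>a\<close> with that
      \<open>j\<close> may have either \<open>i\<close>.\<close>
    obtain j where j: "\<forall>i. \<exists>x y z. (x, y, z) \<in> set (L i j) \<and> (if g then y else z) = v"
      using L v unfolding split_mapping_def by (cases g) (simp; metis)+
    obtain r i b s where r: "1 \<le> r" "r \<le> K" "zigzag K r i = (b, j, s)"
      "b = a \<and> (s \<longleftrightarrow> \<not> g) \<or> b + r = a \<and> (s \<longleftrightarrow> g)"
      using ex_zigzag[of K a j] False a(2) unfolding g_def by auto
    obtain x y z where xyz: "(x, y, z) \<in> set (L i j)" "(if g then y else z) = v" using j by blast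
    note sp = signed_partsI[OF mem[OF r(1-3) xyz(1)], of ?G]
    show ?thesis
    proof (cases "b = a \<and> (s \<longleftrightarrow> \<not> g)")
      case True
      then show ?thesis using sp xyz(2) by (auto split: if_splits)
    next
      case False
      then have *: "b + r = a" "s \<longleftrightarrow> g" using r(4) by auto
      then have "inv\<^bsub>?G\<^esub> (N - a, v) \<in> signed_parts ?G B" using sp xyz(2) by (auto split: if_splits)
      moreover have "inv\<^bsub>?G\<^esub> (N - a, v) = (a, v)" using inv_G[of "N - a" v] a v by (auto simp: N_def)
      ultimately show ?thesis by simp
    qed
  qed
  have "?X \<subseteq> signed_parts ?G B"
  proof
    fix y assume yX: "y \<in> ?X"
    obtain a v where y: "y = (a, v)" by (cases y)
    have a: "1 \<le> a" "a < N" "a \<noteq> 3 * K + 1" and v: "v \<in> carrier V"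
      using yX unfolding y by (auto simp: N_def K_def)
    show "y \<in> signed_parts ?G B"
    proof (cases "a \<le> 3 * K")
      case True
      then show ?thesis unfolding y using pos a v by auto
    next
      case False
      then have "(N - a, v) \<in> signed_parts ?G B" using a v by (intro pos) (auto simp: N_def)
      from G.signed_parts_inv[OF B this] show ?thesis
        unfolding y using inv_G[of "N - a" v] a v by auto
    qed
  qed
  moreover have "6 * card B \<le> card ?X"
  proof -
    have "2 * card (f r i ` set (L i j)) \<le> order V" for r i j
      using card_image_le[of "set (L i j)" "f r i"] card_length[of "L i j"] Lz(2)[of i j] by simp
    then have le: "(\<Sum>(r, i)\<in>{1..K} \<times> UNIV. 2 * card (f r i ` set (L i (fst (snd (zigzag K r i))))))
        \<le> (\<Sum>_\<in>{1..K} \<times> (UNIV :: bool set). order V)"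
      by (intro sum_mono) auto
    have "card B \<le> (\<Sum>(r, i)\<in>{1..K} \<times> UNIV. card (f r i ` set (L i (fst (snd (zigzag K r i))))))"
      unfolding B_def using card_UN_le[of "{1..K} \<times> (UNIV :: bool set)"] by (simp add: split_def)
    then have "2 * card B \<le> (\<Sum>(r, i)\<in>{1..K} \<times> UNIV. 2 * card (f r i ` set (L i (fst (snd (zigzag K r i))))))"
      by (simp add: split_def flip: sum_distrib_left)
    also have "\<dots> \<le> 2 * k * order V" using le by (simp add: card_cartesian_product K_def)
    finally have "6 * card B \<le> 6 * k * order V" by simp
    moreover have "card ?X = 6 * k * order V"
    proof -
      have "card ({1..<6 * int k + 2} - {3 * int k + 1}) = 6 * k" by (subst card_Diff_singleton) auto
      then show ?thesis by (simp add: card_cartesian_product order_def)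
    qed
    ultimately show ?thesis by simp
  qed
  moreover have "finite B" unfolding B_def by auto
  moreover have "?X \<subseteq> carrier ?G" unfolding carrier_DirProd car by (auto simp: N_def K_def)
  moreover have "finite ?X" using V(2) by simp
  ultimately have "decomposable ?G ?X" unfolding decomposable_def using B by blast
  then show ?thesis unfolding n_def .
qed

text \<open>The two layers omitted by the zigzag, 0 and \<open>3 * k + 1\<close>, are precisely
  those of the elements of square \<open>\<one>\<close>, so \<open>E\<close> is empty.\<close>

lemma pyramidal_zigzag:
  fixes V :: "'v monoid"
  assumes V: "comm_group V" "finite (carrier V)" "card (carrier V) = 2 ^ n"
      "\<And>v. v \<in> carrier V \<Longrightarrow> v \<otimes>\<^bsub>V\<^esub> v = \<one>\<^bsub>V\<^esub>"
    and L: "split_mapping V L"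
  shows "pyramidal (Z (6 * k + 2) \<times>\<times> V) ((3 * k + 1) * 2 ^ Suc n) (Suc n) 0"
proof -
  define n' where "n' = 6 * k + 2"
  let ?G = "Z n' \<times>\<times> V"
  interpret G: comm_group ?G using V by (simp add: comm_group_DirProd)
  have n': "int n' = 6 * int k + 2" unfolding n'_def by simp
  have car: "carrier (Z n') = {0..<6 * int k + 2}" using n' by (simp add: carrier_Z)
  have I: "{x \<in> carrier ?G. x \<otimes>\<^bsub>?G\<^esub> x = \<one>\<^bsub>?G\<^esub>} = {0, 3 * int k + 1} \<times> carrier V"
  proof (rule Set.set_eqI)
    fix x :: "int \<times> 'v"
    obtain a v where x: "x = (a, v)" by (cases x)
    have "(a + a) mod (6 * int k + 2) = 2 * (a mod (3 * int k + 1))"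
      using mult_mod_right[of 2 a "3 * int k + 1"] by simp
    then have "(a + a) mod (6 * int k + 2) = 0 \<longleftrightarrow> 3 * int k + 1 dvd a"
      by (simp only: mult_eq_0_iff dvd_eq_mod_eq_0) simp
    then show "x \<in> {x \<in> carrier ?G. x \<otimes>\<^bsub>?G\<^esub> x = \<one>\<^bsub>?G\<^esub>} \<longleftrightarrow> x \<in> {0, 3 * int k + 1} \<times> carrier V"
      unfolding x using V(4)[of v] dvd_lt_double_iff[of a "3 * int k + 1"]
      by (auto simp: car n')
  qed
  have "carrier ?G - {x. x \<otimes>\<^bsub>?G\<^esub> x = \<one>\<^bsub>?G\<^esub>} = carrier ?G - {x \<in> carrier ?G. x \<otimes>\<^bsub>?G\<^esub> x = \<one>\<^bsub>?G\<^esub>}" by blast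
  also have "\<dots> = ({1..<6 * int k + 2} - {3 * int k + 1}) \<times> carrier V"
    unfolding I by (auto simp: car)
  finally have "decomposable ?G (carrier ?G - {x. x \<otimes>\<^bsub>?G\<^esub> x = \<one>\<^bsub>?G\<^esub>})"
    using decomposable_zigzag[OF V(1,2,4) L, of k] unfolding n'_def by simp
  moreover have "card {x \<in> carrier ?G. x \<otimes>\<^bsub>?G\<^esub> x = \<one>\<^bsub>?G\<^esub>} = 2 ^ Suc n"
    unfolding I by (simp add: card_cartesian_product V(3))
  moreover have "order ?G = (3 * k + 1) * 2 ^ Suc n"
    unfolding order_def by (simp add: car card_cartesian_product V(3) nat_add_distrib)
  moreover have "finite (carrier ?G)" using V(2) by (simp add: car)
  ultimately have "pyramidal ?G ((3 * k + 1) * 2 ^ Suc n) (Suc n) 0"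
    unfolding pyramidal_def using G.comm_group_axioms by (intro conjI exI[of _ "{}"]) auto
  then show ?thesis unfolding n'_def .
qed

section \<open>Instances for the ranks 3 and 4\<close>

text \<open>The halves of the first, second and third components are given by the last coordinate,
  the first coordinate and the sum of both.\<close>

lemma split_mapping_2_2:
  "split_mapping (Z 2 \<times>\<times> Z 2)
    (\<lambda>i j. if \<not> i \<and> \<not> j then [((0, 0), (0, 0), (0, 0)), ((1, 0), (0, 1), (1, 1))]
       else if \<not> i then [((0, 0), (1, 0), (1, 0)), ((1, 0), (1, 1), (0, 1))]
       else if \<not> j then [((0, 1), (0, 1), (0, 0)), ((1, 1), (0, 0), (1, 1))]
       else [((0, 1), (1, 1), (1, 0)), ((1, 1), (1, 0), (0, 1))])"
  unfolding split_mapping_def by (simp add: Z_simps all_bool_eq ex_bool_eq, blast?)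

text \<open>The halves of the first, second and third components are given by the last, the middle
  and the first coordinate.\<close>

lemma split_mapping_2_2_2:
  "split_mapping (Z 2 \<times>\<times> Z 2 \<times>\<times> Z 2)
    (\<lambda>i j. if \<not> i \<and> \<not> j then [((0, 0, 0), (0, 0, 0), (0, 0, 0)), ((0, 1, 0), (0, 0, 1), (0, 1, 1)),
          ((1, 0, 0), (1, 0, 1), (0, 0, 1)), ((1, 1, 0), (1, 0, 0), (0, 1, 0))]
       else if \<not> i then [((0, 0, 0), (1, 1, 0), (1, 1, 0)), ((0, 1, 0), (1, 1, 1), (1, 0, 1)),
          ((1, 0, 0), (0, 1, 1), (1, 1, 1)), ((1, 1, 0), (0, 1, 0), (1, 0, 0))]
       else if \<not> j then [((0, 0, 1), (0, 0, 0), (0, 0, 1)), ((0, 1, 1), (0, 0, 1), (0, 1, 0)),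
          ((1, 0, 1), (1, 0, 1), (0, 0, 0)), ((1, 1, 1), (1, 0, 0), (0, 1, 1))]
       else [((0, 0, 1), (1, 1, 0), (1, 1, 1)), ((0, 1, 1), (1, 1, 1), (1, 0, 0)),
          ((1, 0, 1), (0, 1, 1), (1, 1, 0)), ((1, 1, 1), (0, 1, 0), (1, 0, 1))])"
  unfolding split_mapping_def by (simp add: Z_simps all_bool_eq ex_bool_eq, blast?)

lemma exponent_2: "v \<in> carrier (Z 2 \<times>\<times> Z 2) \<Longrightarrow> v \<otimes>\<^bsub>Z 2 \<times>\<times> Z 2\<^esub> v = \<one>\<^bsub>Z 2 \<times>\<times> Z 2\<^esub>"
  "w \<in> carrier (Z 2 \<times>\<times> Z 2 \<times>\<times> Z 2) \<Longrightarrow> w \<otimes>\<^bsub>Z 2 \<times>\<times> Z 2 \<times>\<times> Z 2\<^esub> w = \<one>\<^bsub>Z 2 \<times>\<times> Z 2 \<times>\<times> Z 2\<^esub>"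
  by (auto simp: Z_simps)

lemma comm_group_2_2: "comm_group (Z 2 \<times>\<times> Z 2)" "comm_group (Z 2 \<times>\<times> Z 2 \<times>\<times> Z 2)"
  by (simp_all add: comm_group_DirProd)

lemma has_complete_mapping_1: "has_complete_mapping (Z 1)"
  by (rule has_complete_mapping_by_list[where ts = "[(0, 0, 0)]"]) (simp_all add: Z_simps)

lemma has_complete_mapping_3: "has_complete_mapping (Z 3)"
  by (rule has_complete_mapping_by_list[where ts = "[(0, 0, 0), (1, 1, 1), (2, 2, 2)]"]) (simp_all add: Z_simps)

lemma pyramidal_base_0:
  "pyramidal (Z (6 * k + 2) \<times>\<times> Z 2 \<times>\<times> Z 2) ((3 * k + 1) * 2 ^ 3) 3 0"
  "pyramidal (Z (6 * k + 2) \<times>\<times> Z 2 \<times>\<times> Z 2 \<times>\<times> Z 2) ((3 * k + 1) * 2 ^ 4) 4 0"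
  using pyramidal_zigzag[OF comm_group_2_2(1) _ _ exponent_2(1) split_mapping_2_2, of 2 k]
    pyramidal_zigzag[OF comm_group_2_2(2) _ _ exponent_2(2) split_mapping_2_2_2, of 3 k]
  by (simp_all add: Z_simps)

lemma pyramidal_base_1:
  assumes "odd k"
  shows "pyramidal (Z 3 \<times>\<times> Z k \<times>\<times> Z 1 \<times>\<times> Z (2 ^ Suc l) \<times>\<times> Z 2 \<times>\<times> Z 2 \<times>\<times> Z 2) (3 * k * 2 ^ (l + 4)) 4 1"
proof -
  let ?V = "Z 2 \<times>\<times> Z 2 \<times>\<times> Z 2"
  have T: "{(1, 0)} \<union> m_inv (Z 3 \<times>\<times> Z 1) ` {(1, 0)} = {(1, 0), (2, 0)}"
    by (auto simp: Z_simps)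
  have "pyramidal (Z 3 \<times>\<times> Z k \<times>\<times> Z 1 \<times>\<times> Z (2 ^ Suc l) \<times>\<times> ?V) (3 * 1 * k * 2 ^ (l + Suc 3)) (Suc 3) (card {(1 :: int, 0 :: int)})"
  proof (rule pyramidal_times_2_power_odd)
    show "has_complete_mapping (Z 1 \<times>\<times> Z N \<times>\<times> ?V)" if "N \<in> {2, 4}" for N
      using that has_complete_mapping_2_2_2_2 has_complete_mapping_4_2_2_2
      by (intro has_complete_mapping_DirProd[OF has_complete_mapping_1]) auto
    show "decomposable (Z 3 \<times>\<times> Z 1 \<times>\<times> Z N \<times>\<times> ?V)
        (carrier (Z 3 \<times>\<times> Z 1 \<times>\<times> Z N \<times>\<times> ?V) - special ?V ({(1, 0)} \<union> m_inv (Z 3 \<times>\<times> Z 1) ` {(1, 0)}) N)"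
      if "N \<in> {2, 4}" for N
      using that decomposable_3_1_2_2_2_2 decomposable_3_1_4_2_2_2 unfolding T special_def by auto
    show "v \<otimes>\<^bsub>?V\<^esub> v = \<one>\<^bsub>?V\<^esub>" if "v \<in> carrier ?V" for v using that by (rule exponent_2)
  qed (auto simp: Z_simps comm_group_2_2 has_complete_mapping_2_2_2 assms)
  then show ?thesis by simp
qed

lemma pyramidal_base_2:
  assumes "odd k"
  shows "pyramidal (Z 3 \<times>\<times> Z k \<times>\<times> Z 3 \<times>\<times> Z (2 ^ Suc l) \<times>\<times> Z 2 \<times>\<times> Z 2) (9 * k * 2 ^ (l + 3)) 3 2"
proof -
  let ?V = "Z 2 \<times>\<times> Z 2"
  have T: "{(1, 0), (0, 1)} \<union> m_inv (Z 3 \<times>\<times> Z 3) ` {(1, 0), (0, 1)} = {(1, 0), (2, 0), (0, 1), (0, 2)}"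
    by (auto simp: Z_simps)
  have "pyramidal (Z 3 \<times>\<times> Z k \<times>\<times> Z 3 \<times>\<times> Z (2 ^ Suc l) \<times>\<times> ?V) (3 * 3 * k * 2 ^ (l + Suc 2)) (Suc 2) (card {(1 :: int, 0 :: int), (0, 1)})"
  proof (rule pyramidal_times_2_power_odd)
    show "has_complete_mapping (Z 3 \<times>\<times> Z N \<times>\<times> ?V)" if "N \<in> {2, 4}" for N
      using that has_complete_mapping_2_2_2 has_complete_mapping_4_2_2
      by (intro has_complete_mapping_DirProd[OF has_complete_mapping_3]) auto
    show "decomposable (Z 3 \<times>\<times> Z 3 \<times>\<times> Z N \<times>\<times> ?V)
        (carrier (Z 3 \<times>\<times> Z 3 \<times>\<times> Z N \<times>\<times> ?V) - special ?V ({(1, 0), (0, 1)} \<union> m_inv (Z 3 \<times>\<times> Z 3) ` {(1, 0), (0, 1)}) N)"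
      if "N \<in> {2, 4}" for N
      using that decomposable_3_3_2_2_2 decomposable_3_3_4_2_2 unfolding T special_def by auto
    show "v \<otimes>\<^bsub>?V\<^esub> v = \<one>\<^bsub>?V\<^esub>" if "v \<in> carrier ?V" for v using that by (rule exponent_2)
  qed (auto simp: Z_simps comm_group_2_2 has_complete_mapping_2_2 assms)
  then show ?thesis by (simp add: numeral_2_eq_2[symmetric])
qed

section \<open>Assembly of the congruence cases\<close>

lemma pyramidal_lift:
  fixes G :: "'a monoid"
  assumes "pyramidal G n' m' e" "e \<in> {0, 1, 2}" "m = m' + 2 * j" "n = 4 ^ j * n'"
  shows "\<exists>G :: nat monoid. \<exists>e\<in>{0, 1, 2}. pyramidal G n m e"
proof -
  obtain H :: "nat monoid" where "pyramidal H n' m' e" using pyramidal_nat[OF assms(1)] by blast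
  from pyramidal_times_2_power[OF this, of j] show ?thesis using assms(2-4) by blast
qed

text \<open>As 2 is -1 modulo 3, the two signs cancel. Thus \<open>2 ^ (l + 1) * d\<close> has the
  form \<open>6 * k + 2\<close> used by the zigzag.\<close>

lemma two_power_times_mod_3:
  assumes "[int d = (-1) ^ l] (mod 6)"
  shows "(2 ^ l * d) mod 3 = 1"
proof -
  have "[int d = (-1) ^ l] (mod 3)" using assms by (rule cong_dvd_modulus) simp
  moreover have "[(2::int) ^ l = (-1) ^ l] (mod 3)" by (intro cong_pow) (simp add: cong_def)
  ultimately have "[2 ^ l * int d = (-1) ^ l * (-1) ^ l] (mod 3)" by (intro cong_mult)
  moreover have "(-1) ^ l * (-1) ^ l = (1::int)" by (simp flip: power_mult_distrib)
  ultimately have "[int (2 ^ l * d) = int 1] (mod int 3)" by simp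
  then have "[2 ^ l * d = 1] (mod 3)" by (rule cong_int_iff[THEN iffD1])
  then show ?thesis by (simp add: cong_def)
qed

lemma pyramidal_exists:
  fixes d l m :: nat
  assumes "d \<ge> 1" "odd d" "m \<ge> 3"
    and "[int d = (-1) ^ l] (mod 6) \<or> (even m \<and> [d = 3] (mod 6)) \<or> (odd m \<and> [d = 9] (mod 18))"
  shows "\<exists>G :: nat monoid. \<exists>e\<in>{0, 1, 2}. pyramidal G (2 ^ (l + m) * d) m e"
proof -
  note lift = pyramidal_lift[where m = m and n = "2 ^ (l + m) * d"]
  \<comment> \<open>Here \<open>c\<close> is 3 or 4 according to the parity of \<open>m\<close>, and
    \<open>4 ^ j\<close> comes from \<open>j\<close> Klein four-groups.\<close>
  have pow: "2 ^ (l + (c + 2 * j)) = (2 ^ l * 2 ^ c * 4 ^ j :: nat)" for c j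
    by (simp add: power_add power_mult)
  consider (zero) "[int d = (-1) ^ l] (mod 6)" | (one) "even m" "[d = 3] (mod 6)" | (two) "odd m" "[d = 9] (mod 18)"
    using assms(4) by blast
  then show ?thesis
  proof cases
    case zero
    obtain k where k: "2 ^ l * d = 3 * k + 1"
      using mult_div_mod_eq[of 3 "2 ^ l * d"] two_power_times_mod_3[OF zero]
      by (intro that[of "(2 ^ l * d) div 3"]) linarith
    have n: "2 ^ (l + (c + 2 * j)) * d = 4 ^ j * ((3 * k + 1) * 2 ^ c)" for c j
      unfolding pow k[symmetric] by (simp add: mult_ac)
    show ?thesis
    proof (cases "odd m")
      case True
      then have "\<exists>j. m = 3 + 2 * j" using assms(3) by presburger
      then obtain j where m: "m = 3 + 2 * j" by blast
      show ?thesis by (rule lift[OF pyramidal_base_0(1) _ m]) (simp, unfold m, rule n)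
    next
      case False
      then have "\<exists>j. m = 4 + 2 * j" using assms(3) by presburger
      then obtain j where m: "m = 4 + 2 * j" by blast
      show ?thesis by (rule lift[OF pyramidal_base_0(2) _ m]) (simp, unfold m, rule n)
    qed
  next
    case one
    have "\<exists>j. m = 4 + 2 * j" using one(1) assms(3) by presburger
    then obtain j where m: "m = 4 + 2 * j" by blast
    have "d mod 6 = 3" using one(2) by (simp add: cong_def)
    then have k: "d = 3 * (d div 3)" "odd (d div 3)" by presburger+
    have n: "2 ^ (l + m) * d = 4 ^ j * (3 * (d div 3) * 2 ^ (l + 4))"
      unfolding m pow k(1)[symmetric] by (simp add: power_add)
    show ?thesis by (rule lift[OF pyramidal_base_1[OF k(2)] _ m n]) simp
  next
    case two
    have "\<exists>j. m = 3 + 2 * j" using two(1) assms(3) by presburger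
    then obtain j where m: "m = 3 + 2 * j" by blast
    have "d mod 18 = 9" using two(2) by (simp add: cong_def)
    then have k: "d = 9 * (d div 9)" "odd (d div 9)" by presburger+
    have n: "2 ^ (l + m) * d = 4 ^ j * (9 * (d div 9) * 2 ^ (l + 3))"
      unfolding m pow k(1)[symmetric] by (simp add: power_add)
    show ?thesis by (rule lift[OF pyramidal_base_2[OF k(2)] _ m n]) simp
  qed
qed

theorem theorem3p1:
  fixes d l m :: nat
  assumes "d \<ge> 1" and "odd d" and "m \<ge> 3"
    and "[int d = (-1) ^ l] (mod 6) \<or>
         (even m \<and> [d = 3] (mod 6)) \<or>
         (odd m \<and> [d = 9] (mod 18))"
  shows "\<exists>G :: nat monoid. comm_group G \<and> finite (carrier G) \<and> order G = 2 ^ (l + m) * d \<and>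
           card (involutions G) = 2 ^ m - 1 \<and>
           (\<exists>e \<in> {0, 1, 2}. \<exists>\<T>.
              difference_family_of_type G
                (replicate_mset (2 ^ m - 1) 2 + replicate_mset e 3) \<T>)"
proof -
  obtain G :: "nat monoid" and e where G: "e \<in> {0, 1, 2}" "pyramidal G (2 ^ (l + m) * d) m e"
    using pyramidal_exists[OF assms] by blast
  have "m > 0" using assms(3) by simp
  note pyramidal_imp_difference_family[OF G(2) this]
  moreover have "comm_group G" "finite (carrier G)" "order G = 2 ^ (l + m) * d"
    using G(2) unfolding pyramidal_def by blast+
  ultimately show ?thesis using G(1) by blast
qed

end
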